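(* Let $\mathcal{P}$ be a set of primes of relative density $0$ in the set of all primes and with $\sum_{p\in\mathcal{P}}\frac1p=\infty$, and let $f(n)=(-1)^{\omega_{\mathcal{P}}(n)}$ or $f(n)=(-1)^{\Omega_{\mathcal{P}}(n)}$. Then for any $k\ge1$ and $a_1,\ldots,a_k,h_1,\ldots,h_k\in\mathbb{N}$ with $a_ih_j\ne a_jh_i$ whenever $i\ne j$, $$\lim_{x\to\infty}\frac1x\sum_{n\le x}f(a_1n+h_1)\cdots f(a_kn+h_k)=0.$$
   Context: $\omega_{\mathcal{P}}(n)$ is the number of distinct prime divisors of $n$ lying in $\mathcal{P}$, and $\Omega_{\mathcal{P}}(n)$ is the number of prime divisors of $n$ in $\mathcal{P}$ counted with multiplicity. The relative density of $\mathcal{P}$ in the primes $\mathbb{P}$ is $\lim_{x\to\infty}|\mathcal{P}\cap[1,x]|/|\mathbb{P}\cap[1,x]|$. *)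

theory Defs
  imports "HOL-Analysis.Analysis" "HOL-Computational_Algebra.Primes"
begin

definition omega_in :: "nat set \<Rightarrow> nat \<Rightarrow> nat" where
  "omega_in P n = card {p \<in> prime_factors n. p \<in> P}"

definition bigomega_in :: "nat set \<Rightarrow> nat \<Rightarrow> nat" where
  "bigomega_in P n = size (filter_mset (\<lambda>p. p \<in> P) (prime_factorization n))"

(* The limit is taken over real x; the denominator is positive as soon as x \<ge> 2. *)
definition has_relative_prime_density :: "nat set \<Rightarrow> real \<Rightarrow> bool" where
  "has_relative_prime_density P d \<longleftrightarrow>
     ((\<lambda>x::real. real (card {p \<in> P. 1 \<le> real p \<and> real p \<le> x}) /
                 real (card {p::nat. prime p \<and> 1 \<le> real p \<and> real p \<le> x})) \<longlongrightarrow> d) at_top"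

end

theory Submission
  imports Defs "HOL-Number_Theory.Cong"
begin

text \<open>
  Since \<open>P\<close> has density \<open>0\<close>, Chebyshev's bound gives \<open>\<Sum> 1/p \<rightarrow> 0\<close> over the primes of \<open>P\<close> in \<open>[N powr \<epsilon>, N]\<close>,
  so for almost all \<open>n \<le> N\<close> no prime of \<open>P\<close> beyond \<open>y = N powr \<epsilon>\<close> divides a form \<open>a i * n + h i\<close>. The primes up to
  a constant \<open>w\<close> contribute an almost periodic factor, and a prime \<open>p > w\<close> of \<open>P\<close> divides at most one of the
  forms, almost always only once. What remains is the average of \<open>(-1)\<close> to the number of
  \<open>p \<in> P \<inter> {w<..y}\<close> dividing some form, over a residue class. A Brun sieve compares it with the
  independent model \<open>\<Prod> (1 - 2 k / p)\<close>, which tends to \<open>0\<close> because \<open>\<Sum> 1/p\<close> diverges.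
\<close>

subsection \<open>Truncated expansion\<close>

text \<open>Full inclusion-exclusion over the primes up to y has far too many remainder terms, so it
  is cut off by Brun's levels. Only an absolute error is wanted, not one relative to the model
  product, and this fixes the order of the parameters: w and the exponent bound from the target
  accuracy, then B from the primes that are left, then R to make the rejected mass, about exp (2 *
  B) / 2 ^ R, small, then J from R so that with y = N powr (1 / 2 ^ J) the remainders are at most a
  constant times the square root of N. Density 0 enters through the mass of 1/p on (sqrt t, t]. It
  tends to 0 because about log t dyadic blocks each contribute o(1 / log t). Iterating square roots,
  the mass on (y powr (1 / 2 ^ j), y] grows by an arbitrarily small amount per step in j, slowly
  enough for Rankin's trick, and the mass on (N powr epsilon, N] vanishes for fixed epsilon.\<close>

text \<open>
  Expanding the product over the subsets of \<open>U\<close> and stopping as soon as adding a new smallest element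
  leaves \<open>D\<close>. Taking for \<open>w\<close> the indicator of a divisibility condition gives the sieve inequality for a
  single integer, taking \<open>w p = k / p\<close> gives the same truncation for the independent model.
\<close>

lemma sieve_truncation:
  fixes w :: "nat \<Rightarrow> real" and D :: "nat set \<Rightarrow> bool"
  assumes "finite U" and "\<And>p. p \<in> U \<Longrightarrow> 0 \<le> w p \<and> w p \<le> 1"
    and D0: "D {}" and D1: "\<And>B. finite B \<Longrightarrow> B \<noteq> {} \<Longrightarrow> D B \<Longrightarrow> D (B - {Min B})"
  shows "\<bar>(\<Prod>p\<in>U. 1 - 2 * w p) - (\<Sum>B\<in>{B. B \<subseteq> U \<and> D B}. \<Prod>p\<in>B. - 2 * w p)\<bar>
    \<le> (\<Sum>C\<in>{C. C \<subseteq> U \<and> C \<noteq> {} \<and> \<not> D C \<and> D (C - {Min C})}. \<Prod>p\<in>C. 2 * w p)"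
  using assms(1,2)
\<comment> \<open>Elements enter in decreasing order, so the new \<open>q\<close> is the minimum of
  every set that contains it; this matches the deletion of \<open>Min\<close> in the hypothesis on
  \<open>D\<close>.\<close>
proof (induction U rule: finite_linorder_min_induct)
  case empty
  have "{B. B \<subseteq> {} \<and> D B} = {{}}" using D0 by auto
  then show ?case by simp
next
  case (insert q U)
  define S where "S = (\<lambda>U. \<Sum>B\<in>{B. B \<subseteq> U \<and> D B}. \<Prod>p\<in>B. - 2 * w p)"
  define F where "F = (\<lambda>U. \<Sum>C\<in>{C. C \<subseteq> U \<and> C \<noteq> {} \<and> \<not> D C \<and> D (C - {Min C})}. \<Prod>p\<in>C. 2 * w p)"
  \<comment> \<open>An accepted set either survives the arrival of \<open>q\<close>
    (\<open>X\<close>) or stops there (\<open>Y\<close>) and feeds the error term.\<close>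
  define X where "X = {B. B \<subseteq> U \<and> D B \<and> D (insert q B)}"
  define Y where "Y = {B. B \<subseteq> U \<and> D B \<and> \<not> D (insert q B)}"
  have qU: "q \<notin> U" using insert.hyps by auto
  have fU: "finite (Pow U)" using insert.hyps by simp
  have fX: "finite X" "finite Y" unfolding X_def Y_def by (auto intro: finite_subset[OF _ fU])
  have mini: "Min (insert q B) = q" "insert q B - {q} = B" if "B \<subseteq> U" for B
  proof -
    have fB: "finite B" using that insert.hyps finite_subset by blast
    show "Min (insert q B) = q"
      using that insert.hyps fB by (intro Min_eqI) (auto intro: less_imp_le)
    show "insert q B - {q} = B" using that qU by auto
  qed
  have down: "D B" if "B \<subseteq> U" "D (insert q B)" for B
    using D1[of "insert q B"] mini[OF that(1)] that finite_subset[OF that(1)] insert.hyps by auto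
  have ext: "(\<Sum>B\<in>insert q ` Z. \<Prod>p\<in>B. c * w p) = c * w q * (\<Sum>B\<in>Z. \<Prod>p\<in>B. c * w p)"
    if Z: "Z \<subseteq> Pow U" for Z and c :: real
  proof -
    have "inj_on (insert q) Z"
      using Z qU by (intro inj_onI) (metis Pow_iff insert_ident subsetD)
    then have "(\<Sum>B\<in>insert q ` Z. \<Prod>p\<in>B. c * w p) = (\<Sum>B\<in>Z. \<Prod>p\<in>insert q B. c * w p)"
      by (simp add: sum.reindex)
    also have "\<dots> = (\<Sum>B\<in>Z. c * w q * (\<Prod>p\<in>B. c * w p))"
    proof (rule sum.cong[OF refl])
      fix B assume "B \<in> Z"
      then have "B \<subseteq> U" using Z by auto
      then have "finite B" "q \<notin> B" using insert.hyps finite_subset qU by auto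
      then show "(\<Prod>p\<in>insert q B. c * w p) = c * w q * (\<Prod>p\<in>B. c * w p)" by simp
    qed
    finally show ?thesis by (simp add: sum_distrib_left)
  qed
  have "{B. B \<subseteq> insert q U \<and> D B} = {B. B \<subseteq> U \<and> D B} \<union> insert q ` X" (is "?L = ?R")
  proof
    show "?R \<subseteq> ?L" by (auto simp: X_def)
    show "?L \<subseteq> ?R"
    proof
      fix B assume B: "B \<in> ?L"
      show "B \<in> ?R"
      proof (cases "q \<in> B")
        case True
        then have "B = insert q (B - {q})" "B - {q} \<subseteq> U" using B by auto
        moreover have "B - {q} \<in> X" using calculation B down[of "B - {q}"] by (auto simp: X_def)
        ultimately show ?thesis by blast
      next
        case False
        then show ?thesis using B by auto
      qed
    qed
  qed
  then have "S (insert q U) = (\<Sum>B\<in>{B. B \<subseteq> U \<and> D B} \<union> insert q ` X. \<Prod>p\<in>B. - 2 * w p)"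
    unfolding S_def by simp
  also have "\<dots> = S U + (\<Sum>B\<in>insert q ` X. \<Prod>p\<in>B. - 2 * w p)"
    unfolding S_def using fX qU
    by (intro sum.union_disjoint) (auto intro: finite_subset[OF _ fU])
  also have "(\<Sum>B\<in>insert q ` X. \<Prod>p\<in>B. - 2 * w p) = - 2 * w q * (\<Sum>B\<in>X. \<Prod>p\<in>B. - 2 * w p)"
    by (rule ext) (auto simp: X_def)
  finally have S1: "S (insert q U) = S U - 2 * w q * (\<Sum>B\<in>X. \<Prod>p\<in>B. - 2 * w p)" by simp
  have "{B. B \<subseteq> U \<and> D B} = X \<union> Y" by (auto simp: X_def Y_def)
  then have "S U = (\<Sum>B\<in>X \<union> Y. \<Prod>p\<in>B. - 2 * w p)" unfolding S_def by simp
  also have "\<dots> = (\<Sum>B\<in>X. \<Prod>p\<in>B. - 2 * w p) + (\<Sum>B\<in>Y. \<Prod>p\<in>B. - 2 * w p)"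
    using fX by (intro sum.union_disjoint) (auto simp: X_def Y_def)
  finally have S2: "(\<Sum>B\<in>X. \<Prod>p\<in>B. - 2 * w p) = S U - (\<Sum>B\<in>Y. \<Prod>p\<in>B. - 2 * w p)" by simp
  have "{C. C \<subseteq> insert q U \<and> C \<noteq> {} \<and> \<not> D C \<and> D (C - {Min C})}
     = {C. C \<subseteq> U \<and> C \<noteq> {} \<and> \<not> D C \<and> D (C - {Min C})} \<union> insert q ` Y" (is "?L = ?R")
  proof
    show "?R \<subseteq> ?L" using mini by (auto simp: Y_def)
    show "?L \<subseteq> ?R"
    proof
      fix B assume B: "B \<in> ?L"
      show "B \<in> ?R"
      proof (cases "q \<in> B")
        case True
        then have 1: "B = insert q (B - {q})" "B - {q} \<subseteq> U" using B by auto
        moreover have "Min B = q" using mini(1)[OF 1(2)] 1(1) by simp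
        ultimately have "B - {q} \<in> Y" using B by (auto simp: Y_def)
        then show ?thesis using 1 by blast
      next
        case False
        then show ?thesis using B by auto
      qed
    qed
  qed
  then have "F (insert q U) = (\<Sum>B\<in>{C. C \<subseteq> U \<and> C \<noteq> {} \<and> \<not> D C \<and> D (C - {Min C})} \<union> insert q ` Y. \<Prod>p\<in>B. 2 * w p)"
    unfolding F_def by simp
  also have "\<dots> = F U + (\<Sum>B\<in>insert q ` Y. \<Prod>p\<in>B. 2 * w p)"
    unfolding F_def using fX qU
    by (intro sum.union_disjoint) (auto intro: finite_subset[OF _ fU])
  also have "(\<Sum>B\<in>insert q ` Y. \<Prod>p\<in>B. 2 * w p) = 2 * w q * (\<Sum>B\<in>Y. \<Prod>p\<in>B. 2 * w p)"
    by (rule ext) (auto simp: Y_def)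
  finally have F1: "F (insert q U) = F U + 2 * w q * (\<Sum>B\<in>Y. \<Prod>p\<in>B. 2 * w p)" .
  define V where "V = (\<Prod>p\<in>U. 1 - 2 * w p)"
  define E where "E = (\<Sum>B\<in>Y. \<Prod>p\<in>B. - 2 * w p)"
  have w: "0 \<le> w q" "w q \<le> 1" using insert.prems by auto
  have V1: "(\<Prod>p\<in>insert q U. 1 - 2 * w p) = (1 - 2 * w q) * V"
    using insert.hyps qU by (simp add: V_def)
  have "\<bar>E\<bar> \<le> (\<Sum>B\<in>Y. \<bar>\<Prod>p\<in>B. - 2 * w p\<bar>)" unfolding E_def by (rule sum_abs)
  also have "\<dots> = (\<Sum>B\<in>Y. \<Prod>p\<in>B. 2 * w p)"
    using insert.prems by (intro sum.cong refl) (auto simp: abs_prod abs_mult Y_def intro!: prod.cong)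
  finally have E: "\<bar>E\<bar> \<le> (\<Sum>B\<in>Y. \<Prod>p\<in>B. 2 * w p)" .
  have IH: "\<bar>V - S U\<bar> \<le> F U" using insert.IH insert.prems unfolding V_def S_def F_def by auto
  \<comment> \<open>The old error is multiplied by \<open>1 - 2 * w q\<close>, which has absolute
    value at most 1 since \<open>w q\<close> lies in [0, 1]; the only new error comes from
    \<open>Y\<close>.\<close>
  have "S (insert q U) = S U - 2 * w q * (S U - E)"
    using S1 unfolding S2 E_def .
  then have "(1 - 2 * w q) * V - S (insert q U) = (1 - 2 * w q) * (V - S U) - 2 * w q * E"
    by (simp add: algebra_simps)
  then have "\<bar>(1 - 2 * w q) * V - S (insert q U)\<bar> \<le> \<bar>1 - 2 * w q\<bar> * \<bar>V - S U\<bar> + 2 * w q * \<bar>E\<bar>"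
    using w by (metis abs_mult abs_of_nonneg abs_triangle_ineq4 mult_nonneg_nonneg zero_le_numeral)
  also have "\<dots> \<le> 1 * F U + 2 * w q * (\<Sum>B\<in>Y. \<Prod>p\<in>B. 2 * w p)"
    using w IH E by (intro add_mono mult_mono) auto
  finally show ?case unfolding F1[unfolded F_def, simplified] V1
    using F1 unfolding S_def F_def by simp
qed

text \<open>The \<open>r\<close>-th largest element of \<open>B\<close> is at most \<open>z r\<close>, for every \<open>r\<close>.\<close>

definition brun_admissible :: "(nat \<Rightarrow> real) \<Rightarrow> nat set \<Rightarrow> bool" where
  "brun_admissible z B \<longleftrightarrow> (\<forall>r\<ge>1. card {p \<in> B. z r < real p} < r)"

lemma brun_admissible_empty: "brun_admissible z {}"
  by (auto simp: brun_admissible_def)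

lemma brun_admissible_subset:
  assumes "brun_admissible z B" "finite B" "A \<subseteq> B"
  shows "brun_admissible z A"
  unfolding brun_admissible_def
proof (intro allI impI)
  fix r :: nat assume "r \<ge> 1"
  have "card {p \<in> A. z r < real p} \<le> card {p \<in> B. z r < real p}"
    using assms by (intro card_mono) auto
  also have "\<dots> < r" using assms \<open>r \<ge> 1\<close> by (auto simp: brun_admissible_def)
  finally show "card {p \<in> A. z r < real p} < r" .
qed

text \<open>The minimum of a set of size s is its s-th largest element, hence at most
  \<open>z s\<close>. Removing it leaves an admissible set of size s - 1.\<close>

lemma brun_admissible_prod_le:
  assumes "brun_admissible z B" "finite B"
  shows "real (\<Prod>B) \<le> (\<Prod>r\<in>{1..card B}. z r)"
  using assms
proof (induction "card B" arbitrary: B)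
  case 0
  then show ?case by simp
next
  case (Suc s)
  then have ne: "B \<noteq> {}" by auto
  let ?m = "Min B"
  have m: "?m \<in> B" using Suc ne by simp
  have "real ?m \<le> z (Suc s)"
  proof (rule ccontr)
    assume "\<not> real ?m \<le> z (Suc s)"
    moreover have "?m \<le> p" if "p \<in> B" for p using Suc.prems that by simp
    ultimately have "{p \<in> B. z (Suc s) < real p} = B"
      by (auto intro: less_le_trans simp: not_le)
    then show False using Suc.prems Suc.hyps(2) unfolding brun_admissible_def
      by (metis One_nat_def Suc_leI less_irrefl zero_less_Suc)
  qed
  moreover have "real (\<Prod>(B - {?m})) \<le> (\<Prod>r\<in>{1..s}. z r)"
    using Suc.hyps(1)[of "B - {?m}"] Suc.hyps(2) Suc.prems m
      brun_admissible_subset[OF Suc.prems, of "B - {?m}"] by (metis Diff_subset card_Diff_singleton diff_Suc_1 finite_Diff)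
  ultimately have "real ?m * real (\<Prod>(B - {?m})) \<le> z (Suc s) * (\<Prod>r\<in>{1..s}. z r)"
    using of_nat_0_le_iff[of ?m] by (intro mult_mono of_nat_0_le_iff order_trans[OF of_nat_0_le_iff[of ?m]])
  moreover have "\<Prod>B = ?m * \<Prod>(B - {?m})" using Suc.prems m by (simp add: prod.remove)
  ultimately show ?case using Suc.hyps(2)[symmetric] by (simp add: mult.commute)
qed

text \<open>If removing the minimum repairs a violation at \<open>r\<close>, then the minimum was
  counted there and exceeds \<open>z r\<close>. So does every other element, which forces
  \<open>r = card C\<close>.\<close>

lemma brun_minimal_inadmissible:
  assumes "finite C" "C \<noteq> {}" "\<not> brun_admissible z C" "brun_admissible z (C - {Min C})" "p \<in> C"
  shows "z (card C) < real p"
proof -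
  let ?m = "Min C"
  have m: "?m \<in> C" using assms by simp
  obtain r where r: "r \<ge> 1" "r \<le> card {p \<in> C. z r < real p}"
    using assms(3) by (auto simp: brun_admissible_def not_less)
  have r2: "card {p \<in> C - {?m}. z r < real p} < r"
    using assms(4) r by (auto simp: brun_admissible_def)
  have zm: "z r < real ?m"
  proof (rule ccontr)
    assume "\<not> z r < real ?m"
    then have "{p \<in> C - {?m}. z r < real p} = {p \<in> C. z r < real p}" by auto
    then show False using r r2 by simp
  qed
  have all: "z r < real p" if "p \<in> C" for p
    using zm Min_le[OF assms(1) that] by (meson less_le_trans of_nat_le_iff)
  then have "{p \<in> C. z r < real p} = C" "{p \<in> C - {?m}. z r < real p} = C - {?m}" by auto
  then have "r = card C" using r r2 m assms(1) by (simp add: card_Diff_singleton)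
  then show ?thesis using all assms(5) by simp
qed

subsection \<open>Counting solutions of divisibility conditions\<close>

text \<open>Induction in steps of \<open>W\<close>: the last block of \<open>W\<close> consecutive
  integers contains exactly one member of the class, and fewer than \<open>W\<close> integers
  contain at most one.\<close>

lemma card_residue_class:
  fixes W b N :: nat
  assumes "W \<ge> 1"
  shows "\<bar>real (card {n \<in> {1..N}. [n = b] (mod W)}) - real N / real W\<bar> \<le> 1"
proof (induction N rule: less_induct)
  case (less N)
  show ?case
  proof (cases "N < W")
    case True
    have "x = y" if "x \<in> {n \<in> {1..N}. [n = b] (mod W)}" "y \<in> {n \<in> {1..N}. [n = b] (mod W)}" for x y
    proof -
      have "[x = y] (mod W)" using that cong_sym cong_trans by blast
      then show ?thesis using that True cong_less_modulus_unique_nat by auto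
    qed
    then have "card {n \<in> {1..N}. [n = b] (mod W)} \<le> 1"
      by (subst card_le_Suc0_iff_eq[simplified One_nat_def[symmetric]]) auto
    moreover have "real N / real W \<le> 1" using True by simp
    moreover have "real N / real W \<ge> 0" by simp
    ultimately show ?thesis by linarith
  next
    case False
    then have NW: "N = (N - W) + W" by simp
    let ?A = "{n \<in> {1..N - W}. [n = b] (mod W)}" and ?B = "{n \<in> {N - W<..N}. [n = b] (mod W)}"
    have "{n \<in> {1..N}. [n = b] (mod W)} = ?A \<union> ?B" using False by auto
    moreover have "card ?B = 1"
    proof -
      \<comment> \<open>The first integer from \<open>N - W + 1\<close> on that is congruent to
        \<open>b\<close>; the offset is computed in the integers because \<open>b\<close> may be
        smaller than the block.\<close>
      define c where "c = N - W + 1 + (nat ((int b - int (N - W + 1)) mod int W))"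
      have c1: "[c = b] (mod W)"
      proof -
        have "int c = int (N - W + 1) + (int b - int (N - W + 1)) mod int W"
          using assms by (simp add: c_def)
        moreover have "(int (N - W + 1) + (int b - int (N - W + 1)) mod int W) mod int W = int b mod int W"
          by (simp add: mod_add_right_eq)
        ultimately have "int c mod int W = int b mod int W" by simp
        then show ?thesis by (simp add: cong_def zmod_int[symmetric])
      qed
      have "(int b - int (N - W + 1)) mod int W < int W" using assms by simp
      then have "nat ((int b - int (N - W + 1)) mod int W) < W" using assms by linarith
      then have c2: "c \<in> {N - W<..N}" using False assms unfolding c_def greaterThanAtMost_iff by linarith
      have "?B = {c}"
      proof (intro equalityI subsetI)
        fix x assume x: "x \<in> ?B"
        then have "[x = c] (mod W)" using c1 cong_sym cong_trans by blast
        moreover have "x < c + W" "c < x + W" using x c2 False by auto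
        ultimately have "x = c"
          by (metis cong_altdef_nat cong_sym diff_less_mono2 dvd_imp_le le_add_diff_inverse2 linorder_le_cases nat_add_left_cancel_less not_le add.commute zero_less_diff le_neq_implies_less)
        then show "x \<in> {c}" by simp
      qed (use c1 c2 in auto)
      then show ?thesis by simp
    qed
    moreover have "?A \<inter> ?B = {}" by auto
    ultimately have "card {n \<in> {1..N}. [n = b] (mod W)} = card ?A + 1"
      by (simp add: card_Un_disjoint)
    moreover have "real N / real W = real (N - W) / real W + 1"
      using assms False by (simp add: of_nat_diff field_simps)
    moreover have "\<bar>real (card ?A) - real (N - W) / real W\<bar> \<le> 1"
      using less.IH[of "N - W"] assms False by simp
    ultimately show ?thesis by simp
  qed
qed

lemma cong_and_linear_dvd:
  fixes W b p a h :: nat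
  assumes "prime p" "coprime a p" "coprime W p"
  obtains c where "\<And>n. [n = b] (mod W) \<and> p dvd a * n + h \<longleftrightarrow> [n = c] (mod W * p)"
proof -
  \<comment> \<open>Among natural numbers \<open>(p - 1) * h\<close> plays the role of -h modulo
    \<open>p\<close>.\<close>
  have "\<exists>x. [a * x = (p - 1) * h] (mod p)"
    by (metis assms(2) cong_mult_lcancel_nat cong_solve_coprime_nat cong_scalar_right mult.assoc mult.left_neutral One_nat_def)
  then obtain r where r: "[a * r = (p - 1) * h] (mod p)" by blast
  have p: "p > 0" using assms prime_gt_0_nat by blast
  have eq: "p dvd a * n + h \<longleftrightarrow> [n = r] (mod p)" for n
  proof -
    have "p dvd a * n + h \<longleftrightarrow> [a * n + h = 0] (mod p)" by (simp add: cong_0_iff)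
    also have "\<dots> \<longleftrightarrow> [a * n + h = (p - 1) * h + h] (mod p)"
    proof -
      have "(p - 1) * h + h = p * h" using p by (cases p) auto
      then have "[(p - 1) * h + h = 0] (mod p)" by (simp add: cong_0_iff)
      then show ?thesis using cong_sym cong_trans by blast
    qed
    also have "\<dots> \<longleftrightarrow> [a * n = (p - 1) * h] (mod p)" by (simp add: cong_add_rcancel_nat)
    also have "\<dots> \<longleftrightarrow> [a * n = a * r] (mod p)" using r cong_sym cong_trans by blast
    also have "\<dots> \<longleftrightarrow> [n = r] (mod p)" using assms(2) by (simp add: cong_mult_lcancel_nat)
    finally show ?thesis .
  qed
  obtain c where c: "[c = b] (mod W)" "[c = r] (mod p)"
    using binary_chinese_remainder_nat[OF assms(3)] by blast
  have "[n = b] (mod W) \<and> p dvd a * n + h \<longleftrightarrow> [n = c] (mod W * p)" for n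
  proof -
    have "[n = b] (mod W) \<and> [n = r] (mod p) \<longleftrightarrow> [n = c] (mod W) \<and> [n = c] (mod p)"
      using c cong_sym cong_trans by blast
    also have "\<dots> \<longleftrightarrow> [n = c] (mod W * p)"
      using assms(3) coprime_cong_mult_nat cong_modulus_mult_nat by (metis mult.commute)
    finally show ?thesis using eq by simp
  qed
  then show thesis using that by blast
qed

text \<open>Each prime of \<open>C\<close> has to choose the form it divides, and the last
  hypothesis makes the choices exclusive. So the condition is a disjoint union of
  \<open>card I ^ card C\<close> residue classes modulo \<open>W * \<Prod>C\<close>, each counted
  with error at most 1. In the induction the new prime is absorbed into the modulus, hence the
  generalisation over \<open>W\<close> and \<open>b\<close>.\<close>

lemma card_linear_forms_divisible:
  fixes a h :: "'i \<Rightarrow> nat" and I :: "'i set" and C :: "nat set" and W b N :: nat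
  assumes "finite C" and "finite I" and "W \<ge> 1"
    and "\<And>p. p \<in> C \<Longrightarrow> prime p" and "\<And>p. p \<in> C \<Longrightarrow> coprime W p"
    and "\<And>p i. p \<in> C \<Longrightarrow> i \<in> I \<Longrightarrow> coprime (a i) p"
    and "\<And>p i j n. p \<in> C \<Longrightarrow> i \<in> I \<Longrightarrow> j \<in> I \<Longrightarrow> p dvd a i * n + h i \<Longrightarrow> p dvd a j * n + h j \<Longrightarrow> i = j"
  shows "\<bar>real (card {n \<in> {1..N}. [n = b] (mod W) \<and> (\<forall>p\<in>C. \<exists>i\<in>I. p dvd a i * n + h i)})
      - real (card I) ^ card C * real N / (real W * real (\<Prod>C))\<bar> \<le> real (card I) ^ card C"
  using assms(1,3-)
proof (induction C arbitrary: W b rule: finite_induct)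
  case empty
  then show ?case using card_residue_class[of W N b] by simp
next
  case (insert p C)
  let ?R = "\<lambda>n. \<forall>p\<in>C. \<exists>i\<in>I. p dvd a i * n + h i"
  let ?k = "real (card I)"
  let ?e = "?k ^ card C * real N / (real (W * p) * real (\<Prod>C))"
  define S where "S = (\<lambda>i. {n \<in> {1..N}. ([n = b] (mod W) \<and> p dvd a i * n + h i) \<and> ?R n})"
  have pp: "prime p" "coprime W p" using insert.prems by auto
  have main: "\<bar>real (card (S i)) - ?e\<bar> \<le> ?k ^ card C" if i: "i \<in> I" for i
  proof -
    have "coprime (a i) p" using insert.prems i by auto
    from cong_and_linear_dvd[OF pp(1) this pp(2)]
    obtain c where c: "\<And>n. [n = b] (mod W) \<and> p dvd a i * n + h i \<longleftrightarrow> [n = c] (mod W * p)" by blast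
    have "\<And>q. q \<in> C \<Longrightarrow> coprime p q"
      using insert.prems insert.hyps pp by (metis insertI2 primes_coprime)
    then have "\<bar>real (card {n \<in> {1..N}. [n = c] (mod W * p) \<and> ?R n}) - ?e\<bar> \<le> ?k ^ card C"
      using insert.prems(1-4) prime_gt_0_nat[OF pp(1)] insert.prems(5)[OF insertI2]
      by (intro insert.IH) (auto simp: Suc_le_eq)
    then show ?thesis unfolding S_def c .
  qed
  have "{n \<in> {1..N}. [n = b] (mod W) \<and> (\<forall>p\<in>insert p C. \<exists>i\<in>I. p dvd a i * n + h i)} = (\<Union>i\<in>I. S i)"
    by (auto simp: S_def)
  moreover have "card (\<Union>i\<in>I. S i) = (\<Sum>i\<in>I. card (S i))"
    using insert.prems(5) assms(2) by (intro card_UN_disjoint) (auto simp: S_def)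
  ultimately have "real (card {n \<in> {1..N}. [n = b] (mod W) \<and> (\<forall>p\<in>insert p C. \<exists>i\<in>I. p dvd a i * n + h i)})
      - ?k * ?e = (\<Sum>i\<in>I. real (card (S i)) - ?e)"
    by (simp add: sum_subtractf)
  moreover have "\<bar>\<Sum>i\<in>I. real (card (S i)) - ?e\<bar> \<le> (\<Sum>i\<in>I. ?k ^ card C)"
    by (rule order_trans[OF sum_abs]) (intro sum_mono main)
  moreover have "?k * ?e = ?k ^ card (insert p C) * real N / (real W * real (\<Prod>(insert p C)))"
    using insert.hyps by (simp add: mult_ac)
  ultimately show ?case using insert.hyps by simp
qed

subsection \<open>A Brun sieve for linear forms\<close>

text \<open>Rankin's trick: each set of size \<open>r\<close> is weighted by \<open>2 ^ r\<close> inside the full product \<open>\<Prod> (1 + 2 t p)\<close>.\<close>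

lemma sum_prod_card_eq_le:
  fixes t :: "'a \<Rightarrow> real"
  assumes "finite U" "\<And>p. p \<in> U \<Longrightarrow> t p \<ge> 0"
  shows "(\<Sum>C | C \<subseteq> U \<and> card C = r. \<Prod>p\<in>C. t p) \<le> exp (2 * (\<Sum>p\<in>U. t p)) / 2 ^ r"
proof -
  have fin: "finite {C. C \<subseteq> U \<and> card C = r}"
    by (rule finite_subset[of _ "Pow U"]) (use assms(1) in auto)
  have "2 ^ r * (\<Sum>C | C \<subseteq> U \<and> card C = r. \<Prod>p\<in>C. t p) = (\<Sum>C | C \<subseteq> U \<and> card C = r. \<Prod>p\<in>C. 2 * t p)"
    by (simp add: sum_distrib_left prod.distrib)
  also have "\<dots> \<le> (\<Sum>C\<in>Pow U. \<Prod>p\<in>C. 2 * t p)"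
    using assms by (intro sum_mono2) (auto intro!: prod_nonneg)
  also have "\<dots> = (\<Prod>p\<in>U. 2 * t p + 1)"
    using assms(1) by (subst prod_add) auto
  also have "\<dots> \<le> (\<Prod>p\<in>U. exp (2 * t p))"
    using assms(2) by (intro prod_mono) (auto intro: order_trans[OF _ exp_ge_add_one_self] simp: add.commute)
  also have "\<dots> = exp (2 * (\<Sum>p\<in>U. t p))"
    using assms(1) by (simp add: exp_sum sum_distrib_left)
  finally show ?thesis by (simp add: field_simps)
qed

section \<open>Levels with halving exponents, and the mass of the rejected sets\<close>

lemma sum_three_quarters_le: "(\<Sum>r\<in>{R<..n}. (3 / 4 :: real) ^ (r - R)) \<le> 3 - 3 * (3 / 4) ^ (n - R)"
\<comment> \<open>The subtracted term is the tail of the geometric series; with it the induction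
  step is an identity.\<close>
proof (induction n)
  case (Suc n)
  show ?case
  proof (cases "R \<le> n")
    case True
    then have "{R<..Suc n} = insert (Suc n) {R<..n}" by auto
    then show ?thesis using Suc True by (simp add: Suc_diff_le)
  qed simp
qed simp

text \<open>With truncated subtraction the first \<open>R\<close> levels all equal \<open>y\<close>.\<close>

definition brun_level :: "nat \<Rightarrow> real \<Rightarrow> nat \<Rightarrow> real" where
  "brun_level R y r = y powr (1 / 2 ^ (r - R))"

lemma sum_brun_exponents: "(\<Sum>r\<in>{1..s}. 1 / 2 ^ (r - R) :: real) = min s R + 1 - 1 / 2 ^ (s - R)"
proof (induction s)
  case (Suc s)
  show ?case
  proof (cases "R \<le> s")
    case True
    then show ?thesis using Suc by (simp add: Suc_diff_le)
  next
    case False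
    then show ?thesis using Suc by simp
  qed
qed simp

text \<open>\<open>R\<close> exponents equal to 1 followed by a geometric series of sum below 1: the
  product is bounded independently of the number of factors.\<close>

lemma prod_brun_level_le:
  assumes "y \<ge> 1"
  shows "(\<Prod>r\<in>{1..s}. brun_level R y r) \<le> y powr (R + 1)"
proof -
  have "(\<Prod>r\<in>{1..s}. brun_level R y r) = y powr (\<Sum>r\<in>{1..s}. 1 / 2 ^ (r - R))"
    using assms by (simp add: brun_level_def powr_sum)
  also have "\<dots> \<le> y powr (R + 1)"
  proof (intro powr_mono assms)
    have "(1 / 2 ^ (s - R) :: real) \<ge> 0" by simp
    then show "(\<Sum>r\<in>{1..s}. 1 / 2 ^ (r - R)) \<le> real (R + 1)"
      unfolding sum_brun_exponents by linarith
  qed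
  finally show ?thesis .
qed

text \<open>This and the next definition name the two index families of
  \<open>sieve_truncation\<close>: the main terms, and the sets at which the expansion
  stops.\<close>

definition brun_accepted :: "(nat set \<Rightarrow> bool) \<Rightarrow> nat set \<Rightarrow> nat set set" where
  "brun_accepted D U = {B. B \<subseteq> U \<and> D B}"

definition brun_rejected :: "(nat set \<Rightarrow> bool) \<Rightarrow> nat set \<Rightarrow> nat set set" where
  "brun_rejected D U = {C. C \<subseteq> U \<and> C \<noteq> {} \<and> \<not> D C \<and> D (C - {Min C})}"

lemma finite_brun: "finite U \<Longrightarrow> finite (brun_accepted D U)" "finite U \<Longrightarrow> finite (brun_rejected D U)"
  unfolding brun_accepted_def brun_rejected_def by (auto intro: finite_subset[of _ "Pow U"])

text \<open>A rejected set is an admissible one with a single further element, which is at most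
  \<open>y\<close>; this accounts for the exponent \<open>R + 2\<close> in place of
  \<open>R + 1\<close>.\<close>

lemma brun_prod_le:
  assumes "finite U" "y \<ge> 1" "\<And>p. p \<in> U \<Longrightarrow> real p \<le> y"
    and B: "B \<in> brun_accepted (brun_admissible (brun_level R y)) U \<union> brun_rejected (brun_admissible (brun_level R y)) U"
  shows "real (\<Prod>B) \<le> y powr (R + 2)"
proof -
  have adm: "real (\<Prod>A) \<le> y powr (R + 1)" if "finite A" "brun_admissible (brun_level R y) A" for A
    using brun_admissible_prod_le[OF that(2,1)] prod_brun_level_le[OF assms(2), of R "card A"] by linarith
  have BU: "B \<subseteq> U" using B by (auto simp: brun_accepted_def brun_rejected_def)
  then have fB: "finite B" using assms(1) finite_subset by blast
  show ?thesis
  proof (cases "brun_admissible (brun_level R y) B")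
    case True
    have "y powr (R + 1) \<le> y powr (R + 2)" using assms(2) by (intro powr_mono) auto
    then show ?thesis using adm[OF fB True] by linarith
  next
    case False
    then have ne: "B \<noteq> {}" and D: "brun_admissible (brun_level R y) (B - {Min B})"
      using B by (auto simp: brun_accepted_def brun_rejected_def)
    have m: "Min B \<in> B" using fB ne by simp
    then have "real (\<Prod>B) = real (Min B) * real (\<Prod>(B - {Min B}))" using fB by (simp add: prod.remove)
    also have "\<dots> \<le> y * y powr (R + 1)"
      using m BU assms(2,3) adm[OF _ D] fB by (intro mult_mono) (auto intro: prod_nonneg)
    also have "\<dots> = y powr (R + 2)" using assms(2) powr_add[of y 1 "real (R + 1)"] by (simp add: add.commute)
    finally show ?thesis .
  qed
qed

text \<open>All elements of a rejected set of size r lie above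
  \<open>y powr (1 / 2 ^ (r - R))\<close>, so Rankin's trick need only be applied to the mass there.
  Per level, that mass may grow by ln (3/2) / 2, so its doubled exponential grows by the factor 3/2;
  against the Rankin factor 1/2 this leaves a geometric series of ratio 3/4.\<close>

lemma sum_brun_rejected_le:
  fixes t :: "nat \<Rightarrow> real"
  assumes fU: "finite U" and "y \<ge> 0" and Uy: "\<And>p. p \<in> U \<Longrightarrow> real p \<le> y" and t: "\<And>p. p \<in> U \<Longrightarrow> t p \<ge> 0"
    and mass: "\<And>j. (\<Sum>p | p \<in> U \<and> y powr (1 / 2 ^ j) < real p. t p) \<le> B + ln (3 / 2) / 2 * real j"
  shows "(\<Sum>C\<in>brun_rejected (brun_admissible (brun_level R y)) U. \<Prod>p\<in>C. t p) \<le> 3 * exp (2 * B) / 2 ^ R"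
proof -
  let ?F = "brun_rejected (brun_admissible (brun_level R y)) U"
  define V where "V = (\<lambda>r. {p. p \<in> U \<and> y powr (1 / 2 ^ (r - R)) < real p})"
  have V: "finite (V r)" "V r \<subseteq> U" for r using fU by (auto simp: V_def)
  have F: "C \<subseteq> V (card C)" "card C \<in> {R<..card U}" if "C \<in> ?F" for C
  proof -
    have C: "C \<subseteq> U" "finite C" "C \<noteq> {}" using that fU finite_subset by (auto simp: brun_rejected_def)
    have "brun_level R y (card C) < real p" if "p \<in> C" for p
      using brun_minimal_inadmissible[OF C(2,3) _ _ that] \<open>C \<in> ?F\<close> by (simp add: brun_rejected_def)
    then show CV: "C \<subseteq> V (card C)" using C(1) by (auto simp: V_def brun_level_def)
    obtain p where p: "p \<in> C" using C(3) by auto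
    \<comment> \<open>Up to size \<open>R\<close> the level is \<open>y\<close> itself, and no
      element of \<open>U\<close> exceeds it.\<close>
    have "R < card C"
    proof (rule ccontr)
      assume "\<not> R < card C"
      then have "y < real p" using CV p assms(2) by (auto simp: V_def)
      then show False using Uy C(1) p by force
    qed
    then show "card C \<in> {R<..card U}" using card_mono[OF fU C(1)] by simp
  qed
  have "(\<Sum>C\<in>?F. \<Prod>p\<in>C. t p) = (\<Sum>r\<in>{R<..card U}. \<Sum>C | C \<in> ?F \<and> card C = r. \<Prod>p\<in>C. t p)"
    using F(2) fU by (intro sum.group[symmetric]) (auto simp: finite_brun)
  also have "\<dots> \<le> (\<Sum>r\<in>{R<..card U}. exp (2 * B) / 2 ^ R * (3 / 4) ^ (r - R))"
  proof (rule sum_mono)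
    fix r assume r: "r \<in> {R<..card U}"
    have "(\<Sum>C | C \<in> ?F \<and> card C = r. \<Prod>p\<in>C. t p) \<le> (\<Sum>C | C \<subseteq> V r \<and> card C = r. \<Prod>p\<in>C. t p)"
    proof (rule sum_mono2)
      show "finite {C. C \<subseteq> V r \<and> card C = r}"
        by (rule finite_subset[of _ "Pow (V r)"]) (use V in auto)
      show "{C. C \<in> ?F \<and> card C = r} \<subseteq> {C. C \<subseteq> V r \<and> card C = r}" using F(1) by auto
      show "0 \<le> (\<Prod>p\<in>C. t p)" if "C \<in> {C. C \<subseteq> V r \<and> card C = r} - {C. C \<in> ?F \<and> card C = r}" for C
        using that V(2)[of r] by (intro prod_nonneg) (auto intro!: t)
    qed
    also have "\<dots> \<le> exp (2 * (\<Sum>p\<in>V r. t p)) / 2 ^ r"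
      using V t by (intro sum_prod_card_eq_le) auto
    also have "\<dots> \<le> exp (2 * B + ln (3 / 2) * real (r - R)) / 2 ^ r"
      using mass[of "r - R"] by (intro divide_right_mono) (auto simp: V_def algebra_simps)
    also have "\<dots> = exp (2 * B) * (3 / 2) ^ (r - R) / 2 ^ r"
      by (simp add: exp_add powr_realpow[symmetric] powr_def mult.commute)
    also have "(2::real) ^ r = 2 ^ R * 2 ^ (r - R)" using r by (simp add: power_add[symmetric])
    also have "exp (2 * B) * (3 / 2) ^ (r - R) / (2 ^ R * 2 ^ (r - R)) = exp (2 * B) / 2 ^ R * ((3 / 2) ^ (r - R) / 2 ^ (r - R))"
      by simp
    also have "(3 / 2 :: real) ^ (r - R) / 2 ^ (r - R) = (3 / 4) ^ (r - R)"
      by (simp add: power_divide[symmetric])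
    finally show "(\<Sum>C | C \<in> ?F \<and> card C = r. \<Prod>p\<in>C. t p) \<le> exp (2 * B) / 2 ^ R * (3 / 4) ^ (r - R)" .
  qed
  also have "\<dots> = exp (2 * B) / 2 ^ R * (\<Sum>r\<in>{R<..card U}. (3 / 4) ^ (r - R))"
    by (simp add: sum_distrib_left)
  also have "\<dots> \<le> exp (2 * B) / 2 ^ R * 3"
  proof (rule mult_left_mono)
    have "(3 / 4 :: real) ^ (card U - R) \<ge> 0" by simp
    then show "(\<Sum>r\<in>{R<..card U}. (3 / 4 :: real) ^ (r - R)) \<le> 3"
      using sum_three_quarters_le[of R "card U"] by linarith
  qed simp
  finally show ?thesis by (simp add: mult.commute)
qed

section \<open>Remainder terms and the sieve inequality\<close>

lemma inj_on_prod_primes: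
  assumes "finite U" "\<And>p. p \<in> U \<Longrightarrow> prime (p::nat)"
  shows "inj_on \<Prod> (Pow U)"
proof (rule inj_onI)
  fix A B assume AB: "A \<in> Pow U" "B \<in> Pow U" "\<Prod>A = \<Prod>B"
  have "p \<in> C \<longleftrightarrow> p dvd \<Prod>C" if "p \<in> U" "C \<subseteq> U" for p C
  proof -
    have "finite C" using that assms(1) finite_subset by blast
    then have "p dvd \<Prod>C \<longleftrightarrow> (\<exists>q\<in>C. p dvd q)" using assms(2) that by (intro prime_dvd_prod_iff) auto
    moreover have "p = q" if "q \<in> C" "p dvd q" for q
      using that assms(2) \<open>p \<in> U\<close> \<open>C \<subseteq> U\<close> by (intro primes_dvd_imp_eq) auto
    ultimately show ?thesis by (metis dvd_refl)
  qed
  then have "p \<in> A \<longleftrightarrow> p \<in> B" if "p \<in> U" for p using AB that by (metis PowD)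
  then show "A = B" using AB(1,2) by blast
qed

text \<open>Sets of primes have distinct products, so there are at most \<open>X\<close> of them.
  Every prime is at least \<open>c\<close>, so each weight is bounded by the product of its set,
  again at most \<open>X\<close>.\<close>

lemma sum_power_card_le:
  fixes \<A> :: "nat set set" and c X :: real
  assumes "finite U" "\<And>p. p \<in> U \<Longrightarrow> prime p" "\<A> \<subseteq> Pow U" "\<And>B. B \<in> \<A> \<Longrightarrow> real (\<Prod>B) \<le> X"
    and "c \<ge> 0" "\<And>p. p \<in> U \<Longrightarrow> c \<le> real p" "X \<ge> 0"
  shows "(\<Sum>B\<in>\<A>. c ^ card B) \<le> X\<^sup>2"
proof -
  have "inj_on \<Prod> \<A>" using inj_on_prod_primes[OF assms(1,2)] assms(3) inj_on_subset by blast
  then have "card \<A> = card (\<Prod> ` \<A>)" by (simp add: card_image)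
  also have "\<dots> \<le> card {1..nat \<lfloor>X\<rfloor>}"
  proof (rule card_mono)
    show "\<Prod> ` \<A> \<subseteq> {1..nat \<lfloor>X\<rfloor>}"
    proof (intro subsetI, elim imageE)
      fix x B assume B: "x = \<Prod>B" "B \<in> \<A>"
      have "0 < p" if "p \<in> B" for p 
        using assms(2)[of p] assms(3) B(2) that prime_gt_0_nat by blast
      then have "0 < \<Prod>B" by (intro prod_pos) auto
      then show "x \<in> {1..nat \<lfloor>X\<rfloor>}" using B assms(4)[of B] by (simp add: le_nat_floor)
    qed
  qed simp
  also have "\<dots> = nat \<lfloor>X\<rfloor>" by simp
  finally have "real (card \<A>) \<le> X" using assms(7) by linarith
  moreover have "c ^ card B \<le> X" if "B \<in> \<A>" for B
  proof -
    have "c ^ card B = (\<Prod>p\<in>B. c)" by simp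
    also have "\<dots> \<le> (\<Prod>p\<in>B. real p)" using that assms(3,5,6) by (intro prod_mono) blast
    finally show ?thesis using assms(4)[OF that] by simp
  qed
  then have "(\<Sum>B\<in>\<A>. c ^ card B) \<le> (\<Sum>B\<in>\<A>. X)" by (rule sum_mono)
  moreover have "real (card \<A>) * X \<le> X * X" using calculation(1) assms(7) by (rule mult_right_mono)
  ultimately show ?thesis by (simp add: power2_eq_square)
qed

text \<open>Four quantities are compared in turn: the sign sum, its truncated expansion, the same
  expansion with every count replaced by its expected value, and the model product. Truncation is
  paid for twice, once for the integers and once for the model, hence the factor 2 before the
  rejected mass.\<close>

lemma sieve_estimate:
  fixes a h :: "'i \<Rightarrow> nat" and I :: "'i set" and U :: "nat set" and W b N :: nat
  assumes fU: "finite U" and fI: "finite I" and W: "W \<ge> 1"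
    and pr: "\<And>p. p \<in> U \<Longrightarrow> prime p" and cW: "\<And>p. p \<in> U \<Longrightarrow> coprime W p"
    and ca: "\<And>p i. p \<in> U \<Longrightarrow> i \<in> I \<Longrightarrow> coprime (a i) p"
    and dis: "\<And>p i j n. p \<in> U \<Longrightarrow> i \<in> I \<Longrightarrow> j \<in> I \<Longrightarrow> p dvd a i * n + h i \<Longrightarrow> p dvd a j * n + h j \<Longrightarrow> i = j"
    and large: "\<And>p. p \<in> U \<Longrightarrow> 2 * card I \<le> p"
    and D0: "D {}" and D1: "\<And>B. finite B \<Longrightarrow> B \<noteq> {} \<Longrightarrow> D B \<Longrightarrow> D (B - {Min B})"
  defines "k \<equiv> real (card I)"
  shows "\<bar>\<Sum>n | n \<in> {1..N} \<and> [n = b] (mod W). (-1) ^ card {p \<in> U. \<exists>i\<in>I. p dvd a i * n + h i}\<bar>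
    \<le> real N * ((\<Prod>p\<in>U. 1 - 2 * k / real p) + 2 * (\<Sum>C\<in>brun_rejected D U. \<Prod>p\<in>C. 2 * k / real p))
      + (\<Sum>B\<in>brun_accepted D U. (2 * k) ^ card B) + (\<Sum>C\<in>brun_rejected D U. (2 * k) ^ card C)"
proof -
  let ?A = "brun_accepted D U" and ?R = "brun_rejected D U"
  define S where "S = {n. n \<in> {1..N} \<and> [n = b] (mod W)}"
  define ind where "ind = (\<lambda>n p. of_bool (\<exists>i\<in>I. p dvd a i * n + h i) :: real)"
  define cnt where "cnt = (\<lambda>B. \<Sum>n\<in>S. \<Prod>p\<in>B. ind n p)"
  define e where "e = (\<lambda>B. \<Prod>p\<in>B. k / real p)"
  define V where "V = (\<Prod>p\<in>U. 1 - 2 * k / real p)"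
  define x where "x = real N / real W"
  have fS: "finite S" by (simp add: S_def)
  have sub: "B \<subseteq> U" "finite B" if "B \<in> ?A \<union> ?R" for B
    using that fU finite_subset by (auto simp: brun_accepted_def brun_rejected_def)
  have cnt: "\<bar>cnt B - x * e B\<bar> \<le> k ^ card B" if B: "B \<in> ?A \<union> ?R" for B
  proof -
    note B' = sub[OF B]
    have "(\<Prod>p\<in>B. ind n p) = of_bool (\<forall>p\<in>B. \<exists>i\<in>I. p dvd a i * n + h i)" for n
      using B'(2) unfolding ind_def by (induction B rule: finite_induct) auto
    then have "cnt B = real (card (S \<inter> {n. \<forall>p\<in>B. \<exists>i\<in>I. p dvd a i * n + h i}))"
      unfolding cnt_def by (simp add: fS)
    also have "S \<inter> {n. \<forall>p\<in>B. \<exists>i\<in>I. p dvd a i * n + h i}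
       = {n \<in> {1..N}. [n = b] (mod W) \<and> (\<forall>p\<in>B. \<exists>i\<in>I. p dvd a i * n + h i)}"
      by (auto simp: S_def)
    finally have c: "cnt B = real (card {n \<in> {1..N}. [n = b] (mod W) \<and> (\<forall>p\<in>B. \<exists>i\<in>I. p dvd a i * n + h i)})" .
    have "x * e B = k ^ card B * real N / (real W * real (\<Prod>B))"
      by (simp add: x_def e_def prod_dividef)
    then show ?thesis unfolding c k_def
      using B' assms by (simp, intro card_linear_forms_divisible[simplified]) (auto simp: k_def)
  qed
  have scale: "(\<Prod>p\<in>B. c * g p) = c ^ card B * (\<Prod>p\<in>B. g p)" for c :: real and g and B :: "nat set"
    by (simp add: prod.distrib)
  have G: "(-1) ^ card {p \<in> U. \<exists>i\<in>I. p dvd a i * n + h i} = (\<Prod>p\<in>U. 1 - 2 * ind n p)" for n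
  proof -
    have "(\<Prod>p\<in>U. 1 - 2 * ind n p) = (\<Prod>p\<in>U. if \<exists>i\<in>I. p dvd a i * n + h i then -1 else 1)"
      by (intro prod.cong) (auto simp: ind_def)
    also have "\<dots> = (\<Prod>p | p \<in> U \<and> (\<exists>i\<in>I. p dvd a i * n + h i). -1)"
      using fU by (simp flip: prod.inter_filter)
    finally show ?thesis by simp
  qed
  \<comment> \<open>Truncation for each single \<open>n\<close>, summed over the residue class; the
    rejected terms are then turned into expected values plus remainders.\<close>
  have "\<bar>(\<Sum>n\<in>S. \<Prod>p\<in>U. 1 - 2 * ind n p) - (\<Sum>B\<in>?A. (-2) ^ card B * cnt B)\<bar>
      = \<bar>\<Sum>n\<in>S. (\<Prod>p\<in>U. 1 - 2 * ind n p) - (\<Sum>B\<in>?A. \<Prod>p\<in>B. - 2 * ind n p)\<bar>"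
    unfolding scale cnt_def by (simp add: sum_subtractf sum_distrib_left sum.swap[of _ S])
  also have "\<dots> \<le> (\<Sum>n\<in>S. \<Sum>C\<in>?R. \<Prod>p\<in>C. 2 * ind n p)"
    unfolding brun_accepted_def brun_rejected_def
    by (rule order_trans[OF sum_abs], intro sum_mono sieve_truncation fU D0 D1) (auto simp: ind_def)
  also have "\<dots> = (\<Sum>C\<in>?R. 2 ^ card C * cnt C)"
    unfolding scale cnt_def by (simp add: sum_distrib_left sum.swap[of _ S])
  also have "\<dots> \<le> (\<Sum>C\<in>?R. 2 ^ card C * (x * e C + k ^ card C))"
    using cnt by (intro sum_mono mult_left_mono) (auto simp: abs_le_iff algebra_simps)
  also have "\<dots> = x * (\<Sum>C\<in>?R. \<Prod>p\<in>C. 2 * (k / real p)) + (\<Sum>C\<in>?R. (2 * k) ^ card C)"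
    unfolding scale e_def by (simp add: sum.distrib sum_distrib_left algebra_simps power_mult_distrib)
  finally have b1: "\<bar>(\<Sum>n\<in>S. \<Prod>p\<in>U. 1 - 2 * ind n p) - (\<Sum>B\<in>?A. (-2) ^ card B * cnt B)\<bar>
     \<le> x * (\<Sum>C\<in>?R. \<Prod>p\<in>C. 2 * (k / real p)) + (\<Sum>C\<in>?R. (2 * k) ^ card C)" .
  \<comment> \<open>Counts replaced by expected values, with error \<open>k ^ card B\<close> for
    each accepted set.\<close>
  have "\<bar>(\<Sum>B\<in>?A. (-2) ^ card B * cnt B) - (\<Sum>B\<in>?A. (-2) ^ card B * (x * e B))\<bar>
     = \<bar>\<Sum>B\<in>?A. (-2) ^ card B * (cnt B - x * e B)\<bar>"
    by (simp add: sum_subtractf algebra_simps)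
  also have "\<dots> \<le> (\<Sum>B\<in>?A. 2 ^ card B * k ^ card B)"
    by (rule order_trans[OF sum_abs], intro sum_mono)
       (auto simp: abs_mult power_abs intro!: mult_left_mono cnt)
  finally have b2: "\<bar>(\<Sum>B\<in>?A. (-2) ^ card B * cnt B) - (\<Sum>B\<in>?A. (-2) ^ card B * (x * e B))\<bar>
     \<le> (\<Sum>B\<in>?A. (2 * k) ^ card B)" by (simp add: power_mult_distrib)
  \<comment> \<open>The size hypothesis \<open>large\<close> makes the model factors nonnegative, so
    that \<open>x = N / W\<close> may later be enlarged to \<open>N\<close> in front of their
    product.\<close>
  have kp: "0 \<le> k / real p \<and> k / real p \<le> 1 \<and> 2 * (k / real p) \<le> 1" if "p \<in> U" for p
  proof -
    have "2 * k \<le> real p" using large[OF that] unfolding k_def by linarith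
    then show ?thesis using prime_gt_0_nat[OF pr[OF that]] by (auto simp: k_def field_simps)
  qed
  have V0: "V \<ge> 0" unfolding V_def using kp by (intro prod_nonneg) auto
  \<comment> \<open>The same truncation run backwards, from the truncated model to the full
    product.\<close>
  have "\<bar>(\<Prod>p\<in>U. 1 - 2 * (k / real p)) - (\<Sum>B\<in>?A. \<Prod>p\<in>B. - 2 * (k / real p))\<bar> \<le> (\<Sum>C\<in>?R. \<Prod>p\<in>C. 2 * (k / real p))"
    unfolding brun_accepted_def brun_rejected_def
    using kp by (intro sieve_truncation fU D0 D1) auto
  then have b3: "\<bar>V - (\<Sum>B\<in>?A. (-2) ^ card B * e B)\<bar> \<le> (\<Sum>C\<in>?R. \<Prod>p\<in>C. 2 * (k / real p))"
    unfolding scale e_def V_def by simp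
  have x0: "0 \<le> x" "x \<le> real N"
    using W by (auto simp: x_def divide_le_eq mult_le_cancel_left1)
  have b4: "\<bar>x * V - (\<Sum>B\<in>?A. (-2) ^ card B * (x * e B))\<bar> \<le> x * (\<Sum>C\<in>?R. \<Prod>p\<in>C. 2 * (k / real p))"
  proof -
    have "x * V - (\<Sum>B\<in>?A. (-2) ^ card B * (x * e B)) = x * (V - (\<Sum>B\<in>?A. (-2) ^ card B * e B))"
      by (simp add: algebra_simps sum_distrib_left)
    then show ?thesis using b3 x0 by (simp add: abs_mult mult_left_mono)
  qed
  define F where "F = (\<Sum>C\<in>?R. \<Prod>p\<in>C. 2 * (k / real p))"
  have F0: "F \<ge> 0" unfolding F_def by (intro sum_nonneg prod_nonneg) (auto simp: k_def)
  have "x * V + 2 * (x * F) \<le> real N * (V + 2 * F)"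
    using mult_right_mono[OF x0(2), of "V + 2 * F"] V0 F0 by (simp add: algebra_simps)
  moreover have "x * V \<ge> 0" using x0 V0 by simp
  ultimately have "\<bar>\<Sum>n\<in>S. \<Prod>p\<in>U. 1 - 2 * ind n p\<bar>
     \<le> real N * (V + 2 * F) + (\<Sum>B\<in>?A. (2 * k) ^ card B) + (\<Sum>C\<in>?R. (2 * k) ^ card C)"
    using b1 b2 b4 unfolding F_def[symmetric] by linarith
  then show ?thesis unfolding G S_def[symmetric] V_def F_def by simp
qed

subsection \<open>Reciprocal sums over sparse sets of primes\<close>

lemma prod_primes_dvd:
  fixes m :: nat
  assumes "finite A" "\<And>p. p \<in> A \<Longrightarrow> prime p" "\<And>p. p \<in> A \<Longrightarrow> p dvd m"
  shows "\<Prod>A dvd m"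
  using assms
proof (induction A rule: finite_induct)
  case (insert p A)
  have "coprime p (\<Prod>A)"
    using insert by (intro prod_coprime_right) (auto intro!: primes_coprime)
  then show ?case using insert by (auto intro: divides_mult)
qed simp

text \<open>Every prime in (n, 2n] divides the numerator of the central binomial coefficient but not
  its denominator, so their product is at most 4 ^ n.\<close>

lemma power_card_primes_le:
  fixes n :: nat
  shows "n ^ card {p. prime p \<and> n < p \<and> p \<le> 2 * n} \<le> 4 ^ n"
proof -
  let ?S = "{p. prime p \<and> n < p \<and> p \<le> 2 * n}"
  have fin: "finite ?S" by (rule finite_subset[of _ "{..2 * n}"]) auto
  have "\<Prod>?S dvd (2 * n) choose n"
  proof -
    have "\<forall>p\<in>?S. p dvd (2 * n) choose n"
    proof
      fix p assume p: "p \<in> ?S"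
      have eq: "fact n * fact (2 * n - n) * ((2 * n) choose n) = (fact (2 * n) :: nat)"
        by (rule binomial_fact_lemma) simp
      have "p dvd (fact (2 * n) :: nat)" using p by (simp add: prime_dvd_fact_iff)
      moreover have "\<not> p dvd (fact n :: nat)" using p by (simp add: prime_dvd_fact_iff)
      ultimately show "p dvd (2 * n) choose n"
        using p eq by (metis (no_types, lifting) add_diff_cancel_left' mem_Collect_eq mult_2 prime_dvd_mult_iff)
    qed
    then show ?thesis using fin by (intro prod_primes_dvd) auto
  qed
  then have "\<Prod>?S \<le> (2 * n) choose n" by (rule dvd_imp_le) simp
  also have "\<dots> \<le> 2 ^ (2 * n)" by (rule binomial_le_pow2)
  also have "(2::nat) ^ (2 * n) = 4 ^ n" by (simp add: power_mult)
  finally have "\<Prod>?S \<le> 4 ^ n" .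
  moreover have "(\<Prod>p\<in>?S. n) \<le> (\<Prod>p\<in>?S. p)" by (rule prod_mono) auto
  ultimately show ?thesis by simp
qed

text \<open>Doubling the range adds at most 2 * 2 ^ i / i primes. With a constant C the induction
  needs (C + 2) * (i + 1) / i <= 2 * C; at i = 2 this says C >= 6, and i = 1 is checked by
  hand.\<close>

lemma card_primes_power_two_le:
  assumes "i \<ge> 1"
  shows "i * card {p. prime p \<and> p \<le> (2::nat) ^ i} \<le> 6 * 2 ^ i"
  using assms
proof (induction i rule: nat_induct_at_least)
  case base
  have "card {p. prime p \<and> p \<le> (2::nat) ^ 1} \<le> card {..(2::nat)}" by (intro card_mono) auto
  then show ?case by simp
next
  case (Suc i)
  let ?c = "card {p. prime p \<and> p \<le> (2::nat) ^ i}" and ?d = "card {p. prime p \<and> (2::nat) ^ i < p \<and> p \<le> 2 * 2 ^ i}"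
  have "(2::nat) ^ (i * ?d) \<le> 2 ^ (2 * 2 ^ i)"
    using power_card_primes_le[of "2 ^ i"] by (simp add: power_mult)
  then have d: "i * ?d \<le> 2 * 2 ^ i" by (rule power_le_imp_le_exp[rotated]) simp
  have "{p. prime p \<and> p \<le> (2::nat) ^ Suc i} = {p. prime p \<and> p \<le> (2::nat) ^ i} \<union> {p. prime p \<and> (2::nat) ^ i < p \<and> p \<le> 2 * 2 ^ i}"
    by auto
  then have "card {p. prime p \<and> p \<le> (2::nat) ^ Suc i} \<le> ?c + ?d"
    by (simp only: card_Un_le)
  then have le: "Suc i * card {p. prime p \<and> p \<le> (2::nat) ^ Suc i} \<le> Suc i * (?c + ?d)" by (rule mult_le_mono2)
  show ?case
  proof (cases "i = 1")
    case True
    have "card {p. prime p \<and> p \<le> (2::nat) ^ Suc i} \<le> card {1..(4::nat)}"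
      using True by (intro card_mono) (auto simp: Suc_le_eq prime_gt_0_nat)
    then show ?thesis using True by simp
  next
    case False
    then have i2: "i \<ge> 2" using Suc by simp
    have "i * (?c + ?d) \<le> 8 * 2 ^ i" using Suc.IH d by (simp add: algebra_simps)
    then have "Suc i * (i * (?c + ?d)) \<le> Suc i * (8 * 2 ^ i)" by (rule mult_le_mono2)
    also have "\<dots> \<le> i * (12 * 2 ^ i)"
    proof -
      have "Suc i * 8 \<le> i * 12" using i2 by simp
      then have "Suc i * 8 * 2 ^ i \<le> i * 12 * 2 ^ i" by (rule mult_le_mono1)
      then show ?thesis by (simp only: mult.assoc)
    qed
    finally have "i * (Suc i * (?c + ?d)) \<le> i * (12 * 2 ^ i)" by (simp only: mult.left_commute)
    then have "Suc i * (?c + ?d) \<le> 12 * 2 ^ i" using i2 by simp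
    then show ?thesis using le by simp
  qed
qed

section \<open>Masses of reciprocals on half-open intervals, which concatenate exactly\<close>

definition recip_mass :: "nat set \<Rightarrow> real \<Rightarrow> real \<Rightarrow> real" where
  "recip_mass P s t = (\<Sum>p | p \<in> P \<and> s < real p \<and> real p \<le> t. 1 / real p)"

lemma finite_nat_real_le: "finite {p::nat. Q p \<and> real p \<le> t}" "finite {p::nat. Q p \<and> s < real p \<and> real p \<le> t}"
  by (rule finite_subset[of _ "{..nat \<lfloor>t\<rfloor>}"]; force simp: le_nat_floor)+

lemma recip_mass_nonneg: "recip_mass P s t \<ge> 0"
  unfolding recip_mass_def by (intro sum_nonneg) auto

lemma recip_mass_mono:
  assumes "P \<subseteq> Q" "s' \<le> s" "t \<le> t'"
  shows "recip_mass P s t \<le> recip_mass Q s' t'"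
  unfolding recip_mass_def
  using assms by (intro sum_mono2 finite_nat_real_le) auto

lemma recip_mass_split:
  assumes "s \<le> t" "t \<le> u"
  shows "recip_mass P s u = recip_mass P s t + recip_mass P t u"
proof -
  have "{p. p \<in> P \<and> s < real p \<and> real p \<le> u}
     = {p. p \<in> P \<and> s < real p \<and> real p \<le> t} \<union> {p. p \<in> P \<and> t < real p \<and> real p \<le> u}"
    using assms by auto
  moreover have "{p. p \<in> P \<and> s < real p \<and> real p \<le> t} \<inter> {p. p \<in> P \<and> t < real p \<and> real p \<le> u} = {}"
    by auto
  ultimately show ?thesis unfolding recip_mass_def
    by (simp add: sum.union_disjoint finite_nat_real_le)
qed

text \<open>A block (2 ^ j, 2 ^ (j + 1)] contains at most delta * 12 * 2 ^ j / (j + 1) elements of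
  \<open>P\<close>, each of reciprocal at most 1 / 2 ^ j. All \<open>m\<close> blocks are bounded by
  the estimate for the first.\<close>

lemma recip_mass_dyadic_le:
  assumes P: "\<And>x. x \<ge> x0 \<Longrightarrow> real (card {p \<in> P. 1 \<le> real p \<and> real p \<le> x})
      \<le> \<delta> * real (card {p::nat. prime p \<and> 1 \<le> real p \<and> real p \<le> x})"
    and "\<delta> \<ge> 0" "x0 \<le> 2 ^ i"
  shows "recip_mass P (2 ^ i) (2 ^ (i + m)) \<le> real m * (12 * \<delta> / (real i + 1))"
proof (induction m)
  case 0
  have "{p. p \<in> P \<and> 2 ^ i < real p \<and> real p \<le> 2 ^ (i + 0)} = {}" by auto
  then show ?case unfolding recip_mass_def by (simp only: sum.empty)
next
  case (Suc m)
  define j where "j = i + m"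
  let ?A = "{p. p \<in> P \<and> 2 ^ j < real p \<and> real p \<le> 2 ^ Suc j}"
  have "(2::real) ^ i \<le> 2 ^ Suc j" by (rule power_increasing) (auto simp: j_def)
  then have x0: "x0 \<le> 2 ^ Suc j" using assms(3) by linarith
  have "recip_mass P (2 ^ j) (2 ^ Suc j) \<le> (\<Sum>p\<in>?A. 1 / 2 ^ j)"
    unfolding recip_mass_def by (intro sum_mono divide_left_mono) (auto intro!: mult_pos_pos dest: order.strict_trans[rotated])
  also have "\<dots> = real (card ?A) / 2 ^ j" by simp
  also have "\<dots> \<le> real (card {p \<in> P. 1 \<le> real p \<and> real p \<le> 2 ^ Suc j}) / 2 ^ j"
  proof -
    have "(1::real) \<le> 2 ^ j" by simp
    then have "?A \<subseteq> {p \<in> P. 1 \<le> real p \<and> real p \<le> 2 ^ Suc j}" by auto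
    moreover have "finite {p \<in> P. 1 \<le> real p \<and> real p \<le> 2 ^ Suc j}"
      by (rule finite_subset[OF _ finite_nat_real_le(1)[of "\<lambda>p. p \<in> P" "2 ^ Suc j"]]) auto
    ultimately show ?thesis by (intro divide_right_mono) (auto intro: card_mono)
  qed
  also have "\<dots> \<le> \<delta> * real (card {p::nat. prime p \<and> 1 \<le> real p \<and> real p \<le> 2 ^ Suc j}) / 2 ^ j"
    by (intro divide_right_mono P x0) auto
  also have "{p::nat. prime p \<and> 1 \<le> real p \<and> real p \<le> 2 ^ Suc j} = {p. prime p \<and> p \<le> 2 ^ Suc j}"
  proof -
    have "real p \<le> 2 ^ Suc j \<longleftrightarrow> p \<le> 2 ^ Suc j" for p
      by (metis of_nat_le_iff of_nat_numeral of_nat_power)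
    then show ?thesis by (auto simp: Suc_le_eq prime_gt_0_nat)
  qed
  also have "\<delta> * real (card {p. prime p \<and> p \<le> (2::nat) ^ Suc j}) / 2 ^ j \<le> \<delta> * (12 * 2 ^ j / (real j + 1)) / 2 ^ j"
  proof -
    have "real (Suc j * card {p. prime p \<and> p \<le> (2::nat) ^ Suc j}) \<le> real (6 * 2 ^ Suc j)"
      using card_primes_power_two_le[of "Suc j"] by (intro of_nat_mono) simp
    then have "real (card {p. prime p \<and> p \<le> (2::nat) ^ Suc j}) \<le> 12 * 2 ^ j / (real j + 1)"
      by (simp add: field_simps)
    then show ?thesis using assms(2) by (intro divide_right_mono mult_left_mono) auto
  qed
  also have "\<dots> = 12 * \<delta> / (real j + 1)" by simp
  also have "\<dots> \<le> 12 * \<delta> / (real i + 1)"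
    using assms(2) by (intro divide_left_mono mult_pos_pos) (auto simp: j_def)
  finally have "recip_mass P (2 ^ j) (2 ^ Suc j) \<le> 12 * \<delta> / (real i + 1)" .
  moreover have "recip_mass P (2 ^ i) (2 ^ Suc j) = recip_mass P (2 ^ i) (2 ^ j) + recip_mass P (2 ^ j) (2 ^ Suc j)"
    by (rule recip_mass_split) (auto simp: j_def intro: power_increasing)
  moreover have "real (Suc m) * (12 * \<delta> / (real i + 1)) = real m * (12 * \<delta> / (real i + 1)) + 12 * \<delta> / (real i + 1)"
    by (simp add: distrib_right add_divide_distrib)
  ultimately show ?case using Suc unfolding j_def add_Suc_right by linarith
qed

text \<open>With sqrt t about 2 ^ L, some \<open>L + 2\<close> dyadic blocks cover (sqrt t, t] and
  each has mass at most 12 * delta / (L + 1): the number of blocks cancels against the logarithm in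
  Chebyshev's bound.\<close>

lemma recip_mass_sqrt_tendsto_0:
  assumes "has_relative_prime_density P 0"
  shows "((\<lambda>t. recip_mass P (sqrt t) t) \<longlongrightarrow> 0) at_top"
proof (rule tendstoI)
  fix \<epsilon> :: real assume \<epsilon>: "\<epsilon> > 0"
  \<comment> \<open>The blocks will add up to at most 24 * delta.\<close>
  define \<delta> where "\<delta> = \<epsilon> / 25"
  have \<delta>: "\<delta> > 0" using \<epsilon> by (simp add: \<delta>_def)
  let ?c = "\<lambda>x. real (card {p \<in> P. 1 \<le> real p \<and> real p \<le> x})"
  let ?d = "\<lambda>x. real (card {p::nat. prime p \<and> 1 \<le> real p \<and> real p \<le> x})"
  have "eventually (\<lambda>x. dist (?c x / ?d x) 0 < \<delta>) at_top"
    using assms \<delta> unfolding has_relative_prime_density_def by (rule tendstoD)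
  then obtain x1 where x1: "\<And>x. x \<ge> x1 \<Longrightarrow> dist (?c x / ?d x) 0 < \<delta>"
    unfolding eventually_at_top_linorder by blast
  \<comment> \<open>From 2 on there is a prime, so the denominator of the density quotient can be
    cleared.\<close>
  define x0 where "x0 = max x1 2"
  have le: "?c x \<le> \<delta> * ?d x" if "x \<ge> x0" for x
  proof -
    have "finite {p::nat. prime p \<and> 1 \<le> real p \<and> real p \<le> x}"
      by (rule finite_subset[OF _ finite_nat_real_le(1)[of "\<lambda>p. True" x]]) auto
    moreover have "2 \<in> {p::nat. prime p \<and> 1 \<le> real p \<and> real p \<le> x}" using that by (simp add: x0_def)
    ultimately have "?d x > 0" unfolding of_nat_0_less_iff card_gt_0_iff by blast
    moreover have "?c x / ?d x < \<delta>" using x1[of x] that by (simp add: x0_def dist_real_def)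
    ultimately show ?thesis by (simp add: field_simps)
  qed
  show "eventually (\<lambda>t. dist (recip_mass P (sqrt t) t) 0 < \<epsilon>) at_top"
    unfolding eventually_at_top_linorder
  proof (intro exI allI impI)
    \<comment> \<open>Since sqrt t <= 2 ^ (L + 1), the bound 2 * x0 <= sqrt t gives x0 <= 2 ^ L, so
      the density estimate is available on every block.\<close>
    fix t :: real assume t: "(2 * x0)\<^sup>2 \<le> t"
    have s: "2 * x0 \<le> sqrt t" using t by (rule real_le_rsqrt)
    then have s1: "sqrt t \<ge> 4" by (simp add: x0_def)
    then have t0: "t \<ge> 0" by (smt (verit) real_sqrt_lt_0_iff)
    have "1 \<le> nat \<lfloor>sqrt t\<rfloor>" using s1 by linarith
    from ex_power_ivl1[of 2, OF _ this]
    obtain L where L: "2 ^ L \<le> nat \<lfloor>sqrt t\<rfloor>" "nat \<lfloor>sqrt t\<rfloor> < 2 ^ (L + 1)" by auto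
    have "real (2 ^ L) \<le> real (nat \<lfloor>sqrt t\<rfloor>)" using L(1) by (rule of_nat_mono)
    moreover have "real (2 ^ L) = 2 ^ L" "real (nat \<lfloor>sqrt t\<rfloor>) \<le> sqrt t" using s1 by (simp, linarith)
    ultimately have L1: "2 ^ L \<le> sqrt t" by linarith
    have "nat \<lfloor>sqrt t\<rfloor> + 1 \<le> 2 ^ (L + 1)" using L(2) by simp
    then have "real (nat \<lfloor>sqrt t\<rfloor> + 1) \<le> real (2 ^ (L + 1))" by (rule of_nat_mono)
    moreover have "real (2 ^ (L + 1)) = 2 ^ (L + 1)" "sqrt t \<le> real (nat \<lfloor>sqrt t\<rfloor> + 1)"
      using s1 by (simp, linarith)
    ultimately have L2: "sqrt t \<le> 2 ^ (L + 1)" by linarith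
    have "t = (sqrt t)\<^sup>2" using t0 by simp
    also have "\<dots> \<le> (2 ^ (L + 1))\<^sup>2" using L2 t0 by (intro power_mono) auto
    also have "\<dots> = 2 ^ (L + (L + 2))" by (simp add: power2_eq_square power_add)
    finally have "recip_mass P (sqrt t) t \<le> recip_mass P (2 ^ L) (2 ^ (L + (L + 2)))"
      using L1 by (intro recip_mass_mono) auto
    also have "\<dots> \<le> real (L + 2) * (12 * \<delta> / (real L + 1))"
      using \<delta> L2 s by (intro recip_mass_dyadic_le[OF le]) auto
    also have "\<dots> \<le> 24 * \<delta>" using \<delta> by (simp add: field_simps)
    also have "\<dots> < \<epsilon>" using \<epsilon> by (simp add: \<delta>_def)
    finally show "dist (recip_mass P (sqrt t) t) 0 < \<epsilon>"
      using recip_mass_nonneg[of P "sqrt t" t] by (simp add: dist_real_def)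
  qed
qed

lemma filterlim_recip_mass_at_top:
  assumes "(\<Sum>\<^sub>\<infinity>p\<in>P. ennreal (1 / real p)) = \<infinity>"
  shows "filterlim (recip_mass P s) at_top at_top"
  unfolding filterlim_at_top_dense
proof
  fix Z :: real
  have "(\<Sum>\<^sub>\<infinity>p\<in>P. ennreal (1 / real p)) = (SUP F\<in>{F. finite F \<and> F \<subseteq> P}. \<Sum>p\<in>F. ennreal (1 / real p))"
    by (rule nonneg_infsum_complete) (rule zero_le)
  \<comment> \<open>The mass up to \<open>s\<close> is added in advance because it is discarded at
    the end. The lower end -1 lets the interval contain 0, whose reciprocal is 0 by convention,
    since \<open>P\<close> is an arbitrary set here.\<close>
  moreover define Z' where "Z' = max 0 Z + recip_mass P (-1) (max s 0)"
  have "ennreal Z' < \<infinity>" by simp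
  ultimately have "\<exists>F\<in>{F. finite F \<and> F \<subseteq> P}. ennreal Z' < (\<Sum>p\<in>F. ennreal (1 / real p))"
    unfolding assms by (simp only: less_SUP_iff[symmetric])
  then obtain F where F: "finite F" "F \<subseteq> P" "ennreal Z' < (\<Sum>p\<in>F. ennreal (1 / real p))" by auto
  have "ennreal Z' < ennreal (\<Sum>p\<in>F. 1 / real p)" using F(3) by simp
  moreover have "Z' \<ge> 0" unfolding Z'_def by (simp add: recip_mass_nonneg)
  ultimately have ZF: "Z' < (\<Sum>p\<in>F. 1 / real p)" by (simp only: ennreal_less_iff)
  show "eventually (\<lambda>y. Z < recip_mass P s y) at_top"
    unfolding eventually_at_top_linorder
  proof (intro exI allI impI)
    fix y :: real assume y: "max (max s 0) (\<Sum>p\<in>F. real p) \<le> y"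
    have Fy: "real p \<le> y" if "p \<in> F" for p
    proof -
      have "real p \<le> (\<Sum>p\<in>F. real p)" using F(1) that by (intro member_le_sum) auto
      then show ?thesis using y by simp
    qed
    have "(\<Sum>p\<in>F. 1 / real p) \<le> recip_mass P (-1) y"
      unfolding recip_mass_def
      using F(2) Fy by (intro sum_mono2 finite_nat_real_le) (auto intro: less_le_trans[of _ 0])
    also have "\<dots> = recip_mass P (-1) (max s 0) + recip_mass P (max s 0) y"
      using y by (intro recip_mass_split) auto
    also have "recip_mass P (max s 0) y \<le> recip_mass P s y" by (rule recip_mass_mono) auto
    finally show "Z < recip_mass P s y" using ZF by (simp add: Z'_def)
  qed
qed

text \<open>Going from \<open>y\<close> down to its 2 ^ j-th root takes j square roots. Each costs
  at most eta while the upper end is beyond a fixed threshold, and all the mass below the threshold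
  is put into \<open>B0\<close>, which depends on neither y nor j.\<close>

lemma recip_mass_root_le:
  assumes "((\<lambda>t. recip_mass P (sqrt t) t) \<longlongrightarrow> 0) at_top" "\<eta> > 0"
  obtains B0 where "\<And>y j. y \<ge> 0 \<Longrightarrow> recip_mass P (y powr (1 / 2 ^ j)) y \<le> B0 + \<eta> * real j"
proof -
  have "eventually (\<lambda>t. dist (recip_mass P (sqrt t) t) 0 < \<eta>) at_top" using assms by (rule tendstoD)
  then obtain t0 where t0: "\<And>t. t \<ge> t0 \<Longrightarrow> recip_mass P (sqrt t) t < \<eta>"
    unfolding eventually_at_top_linorder dist_real_def by (metis abs_le_D1 diff_zero less_imp_le order_le_less_trans order.strict_trans2 abs_ge_self)
  define B0 where "B0 = recip_mass P 0 (max t0 0)"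
  have "recip_mass P (y powr (1 / 2 ^ j)) y \<le> B0 + \<eta> * real j" if "y \<ge> 0" for y j
    using that
  proof (induction j arbitrary: y)
    case 0
    then have "{p. p \<in> P \<and> y powr (1 / 2 ^ 0) < real p \<and> real p \<le> y} = {}" by auto
    then have "recip_mass P (y powr (1 / 2 ^ 0)) y = 0" unfolding recip_mass_def by (simp only: sum.empty)
    then show ?case using recip_mass_nonneg by (simp add: B0_def)
  next
    case (Suc j)
    have root: "y powr (1 / 2 ^ Suc j) = sqrt y powr (1 / 2 ^ j)"
      using Suc.prems by (simp add: powr_half_sqrt[symmetric] powr_powr)
    show ?case
    \<comment> \<open>Otherwise the whole interval is cheap: it lies below the threshold, or for y <
      1 it contains no natural number at all.\<close>
    proof (cases "y \<ge> max t0 1")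
      case True
      have sy: "sqrt y \<ge> 1" "sqrt y \<le> y" using True by (auto simp: real_sqrt_ge_one sqrt_le_D real_le_lsqrt power2_eq_square)
      have "sqrt y powr (1 / 2 ^ j) \<le> sqrt y powr 1" using sy by (intro powr_mono) auto
      then have "recip_mass P (y powr (1 / 2 ^ Suc j)) y
         = recip_mass P (sqrt y powr (1 / 2 ^ j)) (sqrt y) + recip_mass P (sqrt y) y"
        unfolding root using sy by (intro recip_mass_split) auto
      also have "recip_mass P (sqrt y powr (1 / 2 ^ j)) (sqrt y) \<le> B0 + \<eta> * real j"
        using Suc.prems by (intro Suc.IH) auto
      also have "recip_mass P (sqrt y) y \<le> \<eta>" using t0[of y] True by simp
      finally show ?thesis by (simp add: algebra_simps)
    next
      case False
      have "recip_mass P (y powr (1 / 2 ^ Suc j)) y \<le> B0"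
      proof (cases "y \<ge> 1")
        case True
        then show ?thesis using False unfolding B0_def by (intro recip_mass_mono) auto
      next
        case F: False
        have "{p. p \<in> P \<and> y powr (1 / 2 ^ Suc j) < real p \<and> real p \<le> y} = {}"
        proof -
          have "\<not> (y powr (1 / 2 ^ Suc j) < real p \<and> real p \<le> y)" for p
          proof
            assume "y powr (1 / 2 ^ Suc j) < real p \<and> real p \<le> y"
            moreover have "y powr (1 / 2 ^ Suc j) \<ge> 0" by simp
            ultimately have "real p > 0" "real p < 1" using F by linarith+
            then show False by simp
          qed
          then show ?thesis by blast
        qed
        then have "recip_mass P (y powr (1 / 2 ^ Suc j)) y = 0" unfolding recip_mass_def by (simp only: sum.empty)
        then show ?thesis using recip_mass_nonneg by (simp add: B0_def)
      qed
      moreover have "0 \<le> \<eta> * real (Suc j)" using assms(2) by simp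
      ultimately show ?thesis by linarith
    qed
  qed
  then show thesis using that by blast
qed

lemma recip_mass_root_tendsto_0:
  assumes lim: "((\<lambda>t. recip_mass P (sqrt t) t) \<longlongrightarrow> 0) at_top"
  shows "((\<lambda>y. recip_mass P (y powr (1 / 2 ^ j)) y) \<longlongrightarrow> 0) at_top"
proof (induction j)
  case 0
  have "recip_mass P (y powr (1 / 2 ^ 0)) y = 0" if "y \<ge> 0" for y
  proof -
    have "{p. p \<in> P \<and> y powr (1 / 2 ^ 0) < real p \<and> real p \<le> y} = {}" using that by auto
    then show ?thesis unfolding recip_mass_def by (simp only: sum.empty)
  qed
  then have "eventually (\<lambda>y. recip_mass P (y powr (1 / 2 ^ 0)) y = 0) at_top"
    unfolding eventually_at_top_linorder by blast
  then show ?case by (rule tendsto_eventually)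
next
  case (Suc j)
  have "((\<lambda>y. recip_mass P (sqrt y powr (1 / 2 ^ j)) (sqrt y) + recip_mass P (sqrt y) y) \<longlongrightarrow> 0 + 0) at_top"
    by (intro tendsto_add lim filterlim_compose[OF Suc sqrt_at_top])
  moreover have "eventually (\<lambda>y. recip_mass P (sqrt y powr (1 / 2 ^ j)) (sqrt y) + recip_mass P (sqrt y) y
      = recip_mass P (y powr (1 / 2 ^ Suc j)) y) at_top"
    using eventually_ge_at_top[of 1]
  proof eventually_elim
    case (elim y)
    have root: "y powr (1 / 2 ^ Suc j) = sqrt y powr (1 / 2 ^ j)"
      using elim by (simp add: powr_half_sqrt[symmetric] powr_powr)
    have sy: "sqrt y \<ge> 1" "sqrt y \<le> y" using elim by (auto simp: real_sqrt_ge_one sqrt_le_D real_le_lsqrt power2_eq_square)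
    have "sqrt y powr (1 / 2 ^ j) \<le> sqrt y powr 1" using sy by (intro powr_mono) auto
    then show ?case unfolding root using sy by (intro recip_mass_split[symmetric]) auto
  qed
  ultimately show ?case by (simp add: tendsto_cong)
qed

subsection \<open>The sign average over primes in a sparse set\<close>

text \<open>The quotients (a * n + h) / q are distinct positive integers. Unlike a count by residue
  classes, this asks for no coprimality and leaves no additive error, so it can be summed over
  moduli beyond \<open>N\<close>.\<close>

lemma card_dvd_linear_form_le:
  fixes a h q N :: nat
  assumes "a \<ge> 1" "q \<ge> 1"
  shows "real (card {n \<in> {1..N}. q dvd a * n + h}) \<le> real (a + h) * real N / real q"
proof (cases "N = 0")
  case False
  let ?S = "{n \<in> {1..N}. q dvd a * n + h}"
  have "card ?S \<le> card {1..(a * N + h) div q}"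
  proof (rule card_inj_on_le[of "\<lambda>n. (a * n + h) div q"])
    show "inj_on (\<lambda>n. (a * n + h) div q) ?S"
    proof (rule inj_onI)
      fix x y assume xy: "x \<in> ?S" "y \<in> ?S" "(a * x + h) div q = (a * y + h) div q"
      then have "a * x + h = a * y + h" by (metis (mono_tags, lifting) dvd_div_mult_self mem_Collect_eq)
      then show "x = y" using assms by simp
    qed
    show "(\<lambda>n. (a * n + h) div q) ` ?S \<subseteq> {1..(a * N + h) div q}"
    proof (intro subsetI, elim imageE)
      fix x n assume x: "x = (a * n + h) div q" "n \<in> ?S"
      then have "a * n + h > 0" using assms by simp
      then have "q \<le> a * n + h" using x by (auto intro: dvd_imp_le)
      then have "x \<ge> 1" using x assms by (simp add: Suc_le_eq div_greater_zero_iff)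
      moreover have "x \<le> (a * N + h) div q" using x by (auto intro!: div_le_mono)
      ultimately show "x \<in> {1..(a * N + h) div q}" by simp
    qed
  qed simp
  then have "real (card ?S) \<le> real ((a * N + h) div q)" by simp
  also have "\<dots> \<le> real (a * N + h) / real q" by (rule of_nat_div_le_of_nat)
  also have "\<dots> \<le> real ((a + h) * N) / real q"
    using False assms by (intro divide_right_mono of_nat_mono) (cases N; simp)+
  finally show ?thesis by simp
qed simp

text \<open>A union bound over forms and primes. For 1 <= n <= N the values of the forms are
  positive and at most \<open>A * N\<close>, so no larger prime can occur.\<close>

lemma card_large_prime_le:
  fixes a h :: "'i \<Rightarrow> nat" and y :: real
  assumes I: "finite I" "\<And>i. i \<in> I \<Longrightarrow> a i \<ge> 1" and y: "y \<ge> 0"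
    and A: "\<And>i. i \<in> I \<Longrightarrow> a i + h i \<le> A"
  shows "real (card {n \<in> {1..N}. \<exists>p\<in>P. y < real p \<and> (\<exists>i\<in>I. p dvd a i * n + h i)})
    \<le> real (card I) * real A * real N * recip_mass P y (real (A * N))"
proof -
  define Q where "Q = {p. p \<in> P \<and> y < real p \<and> real p \<le> real (A * N)}"
  have fQ: "finite Q" unfolding Q_def by (rule finite_nat_real_le)
  define T where "T = (\<lambda>(i, p). {n \<in> {1..N}. p dvd a i * n + h i})"
  have "{n \<in> {1..N}. \<exists>p\<in>P. y < real p \<and> (\<exists>i\<in>I. p dvd a i * n + h i)} \<subseteq> (\<Union>ip\<in>I \<times> Q. T ip)"
  proof
    fix n assume n: "n \<in> {n \<in> {1..N}. \<exists>p\<in>P. y < real p \<and> (\<exists>i\<in>I. p dvd a i * n + h i)}"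
    then obtain p i where p: "p \<in> P" "y < real p" "i \<in> I" "p dvd a i * n + h i" by auto
    have n1: "1 \<le> n" "n \<le> N" using n by auto
    have "p \<le> a i * n + h i" using p I(2) n1 by (intro dvd_imp_le) (auto simp: Suc_le_eq)
    also have "\<dots> \<le> a i * N + h i * N" using n1 by (intro add_mono) auto
    also have "\<dots> \<le> A * N" using A[OF p(3)] by (metis add_mult_distrib mult_le_mono1)
    finally have "real p \<le> real (A * N)" by (rule of_nat_mono)
    then have "p \<in> Q" using p unfolding Q_def by simp
    then show "n \<in> (\<Union>ip\<in>I \<times> Q. T ip)" using p n by (auto simp: T_def intro!: bexI[of _ p])
  qed
  then have "card {n \<in> {1..N}. \<exists>p\<in>P. y < real p \<and> (\<exists>i\<in>I. p dvd a i * n + h i)} \<le> card (\<Union>ip\<in>I \<times> Q. T ip)"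
    using I fQ by (intro card_mono) (auto simp: T_def)
  also have "\<dots> \<le> (\<Sum>ip\<in>I \<times> Q. card (T ip))" using I fQ by (intro card_UN_le) auto
  finally have "real (card {n \<in> {1..N}. \<exists>p\<in>P. y < real p \<and> (\<exists>i\<in>I. p dvd a i * n + h i)})
     \<le> (\<Sum>ip\<in>I \<times> Q. real (card (T ip)))"
    by (simp only: of_nat_le_iff flip: of_nat_sum)
  also have "\<dots> = (\<Sum>i\<in>I. \<Sum>p\<in>Q. real (card (T (i, p))))" by (simp add: sum.cartesian_product)
  also have "\<dots> \<le> (\<Sum>i\<in>I. \<Sum>p\<in>Q. real A * real N * (1 / real p))"
  proof (intro sum_mono)
    fix i p assume i: "i \<in> I" and p: "p \<in> Q"
    have p1: "p \<ge> 1" using p y by (cases p) (auto simp: Q_def)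
    have "real (card (T (i, p))) \<le> real (a i + h i) * real N / real p"
      using card_dvd_linear_form_le[OF I(2)[OF i] p1] by (simp add: T_def)
    also have "\<dots> \<le> real A * real N / real p"
      using A[OF i] by (intro divide_right_mono mult_right_mono of_nat_mono) auto
    finally show "real (card (T (i, p))) \<le> real A * real N * (1 / real p)" by simp
  qed
  also have "\<dots> = real (card I) * real A * real N * recip_mass P y (real (A * N))"
    by (simp add: recip_mass_def Q_def sum_distrib_left mult.assoc)
  finally show ?thesis .
qed

lemma prod_one_minus_le:
  fixes U :: "nat set" and c :: real
  assumes "finite U" "\<And>p. p \<in> U \<Longrightarrow> 0 < p \<and> c \<le> real p"
  shows "(\<Prod>p\<in>U. 1 - c / real p) \<le> exp (- c * (\<Sum>p\<in>U. 1 / real p))"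
proof -
  have "(\<Prod>p\<in>U. 1 - c / real p) \<le> (\<Prod>p\<in>U. exp (- (c / real p)))"
  proof (intro prod_mono conjI)
    fix p assume "p \<in> U"
    then show "0 \<le> 1 - c / real p" using assms(2)[of p] by (simp add: field_simps)
    show "1 - c / real p \<le> exp (- (c / real p))" using exp_ge_add_one_self[of "- (c / real p)"] by simp
  qed
  also have "\<dots> = exp (- c * (\<Sum>p\<in>U. 1 / real p))"
    using assms(1) by (simp add: exp_sum[symmetric] sum_negf sum_distrib_left)
  finally show ?thesis .
qed

text \<open>The situation after the small primes have been removed from \<open>P\<close>. By
  \<open>dis\<close> a prime selects at most one form, so the signs of the forms combine into a
  single count \<open>divisors_at\<close>; \<open>large\<close> keeps the model factors 1 - 2k/p
  nonnegative.\<close>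

locale linear_forms =
  fixes a h :: "'i \<Rightarrow> nat" and I :: "'i set" and P :: "nat set" and W :: nat
  assumes fI: "finite I" and ne: "I \<noteq> {}" and a1: "\<And>i. i \<in> I \<Longrightarrow> a i \<ge> 1" and W1: "W \<ge> 1"
    and pr: "\<And>p. p \<in> P \<Longrightarrow> prime p" and cW: "\<And>p. p \<in> P \<Longrightarrow> coprime W p"
    and ca: "\<And>p i. p \<in> P \<Longrightarrow> i \<in> I \<Longrightarrow> coprime (a i) p"
    and dis: "\<And>p i j n. p \<in> P \<Longrightarrow> i \<in> I \<Longrightarrow> j \<in> I \<Longrightarrow> p dvd a i * n + h i \<Longrightarrow> p dvd a j * n + h j \<Longrightarrow> i = j"
    and large: "\<And>p. p \<in> P \<Longrightarrow> 2 * card I \<le> p"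
    and sparse: "((\<lambda>t. recip_mass P (sqrt t) t) \<longlongrightarrow> 0) at_top"
    and divergent: "filterlim (recip_mass P 0) at_top at_top"
begin

definition divisors_at :: "nat \<Rightarrow> nat set" where
  "divisors_at n = {p \<in> P. \<exists>i\<in>I. p dvd a i * n + h i}"

text \<open>\<open>sieve_estimate\<close> with Brun's levels. Both remainder sums run over sets of
  product at most \<open>y powr (R + 2)\<close> and cost its square each; 6 is twice the constant 3
  of \<open>sum_brun_rejected_le\<close>.\<close>

lemma small_primes_bound:
  assumes y: "y \<ge> 1"
    and mass: "\<And>j. 2 * real (card I) * recip_mass P (y powr (1 / 2 ^ j)) y \<le> B + ln (3 / 2) / 2 * real j"
  shows "\<bar>\<Sum>n | n \<in> {1..N} \<and> [n = b] (mod W). (-1) ^ card {p. p \<in> divisors_at n \<and> real p \<le> y}\<bar>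
    \<le> real N * (exp (- 2 * real (card I) * recip_mass P 0 y) + 6 * exp (2 * B) / 2 ^ R) + 2 * y powr (2 * (R + 2))"
    (is "\<bar>?sum\<bar> \<le> _")
proof -
  define k where "k = real (card I)"
  define U where "U = {p. p \<in> P \<and> real p \<le> y}"
  have fU: "finite U" unfolding U_def by (rule finite_nat_real_le)
  have U: "p \<in> P" "real p \<le> y" "prime p" "0 < p" "2 * k \<le> real p" if "p \<in> U" for p
    using that pr prime_gt_0_nat large[of p] by (auto simp: U_def k_def)
  let ?D = "brun_admissible (brun_level R y)"
  let ?A = "brun_accepted ?D U" and ?F = "brun_rejected ?D U"
  have "{p. p \<in> divisors_at n \<and> real p \<le> y} = {p \<in> U. \<exists>i\<in>I. p dvd a i * n + h i}" for n
    by (auto simp: divisors_at_def U_def)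
  then have "\<bar>\<Sum>n | n \<in> {1..N} \<and> [n = b] (mod W). (-1) ^ card {p. p \<in> divisors_at n \<and> real p \<le> y}\<bar>
    = \<bar>\<Sum>n | n \<in> {1..N} \<and> [n = b] (mod W). (-1) ^ card {p \<in> U. \<exists>i\<in>I. p dvd a i * n + h i}\<bar>"
    by simp
  also have "\<dots> \<le> real N * ((\<Prod>p\<in>U. 1 - 2 * k / real p) + 2 * (\<Sum>C\<in>?F. \<Prod>p\<in>C. 2 * k / real p))
      + (\<Sum>B\<in>?A. (2 * k) ^ card B) + (\<Sum>C\<in>?F. (2 * k) ^ card C)"
    unfolding k_def
  proof (rule sieve_estimate)
    show "?D (B - {Min B})" if "finite B" "?D B" for B
      using brun_admissible_subset[OF that(2,1)] by auto
    show "i = j" if "p \<in> U" "i \<in> I" "j \<in> I" "p dvd a i * n + h i" "p dvd a j * n + h j" for p i j n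
      using dis that U(1) by blast
  qed (use fU fI W1 U(1) pr cW ca large brun_admissible_empty in auto)
  finally have bound: "\<bar>?sum\<bar> \<le> real N * ((\<Prod>p\<in>U. 1 - 2 * k / real p) + 2 * (\<Sum>C\<in>?F. \<Prod>p\<in>C. 2 * k / real p))
      + (\<Sum>B\<in>?A. (2 * k) ^ card B) + (\<Sum>C\<in>?F. (2 * k) ^ card C)" .
  have V: "(\<Prod>p\<in>U. 1 - 2 * k / real p) \<le> exp (- (2 * k) * (\<Sum>p\<in>U. 1 / real p))"
    using fU U(4,5) by (intro prod_one_minus_le) auto
  have mU: "(\<Sum>p\<in>U. 1 / real p) = recip_mass P 0 y"
    unfolding recip_mass_def U_def using pr prime_gt_0_nat by (intro sum.cong) auto
  have F: "(\<Sum>C\<in>?F. \<Prod>p\<in>C. 2 * k / real p) \<le> 3 * exp (2 * B) / 2 ^ R"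
  proof (rule sum_brun_rejected_le)
    fix j :: nat
    have "{p. p \<in> U \<and> y powr (1 / 2 ^ j) < real p} = {p. p \<in> P \<and> y powr (1 / 2 ^ j) < real p \<and> real p \<le> y}"
      by (auto simp: U_def)
    then have "(\<Sum>p | p \<in> U \<and> y powr (1 / 2 ^ j) < real p. 2 * k / real p) = 2 * k * recip_mass P (y powr (1 / 2 ^ j)) y"
      by (simp add: recip_mass_def sum_distrib_left)
    then show "(\<Sum>p | p \<in> U \<and> y powr (1 / 2 ^ j) < real p. 2 * k / real p) \<le> B + ln (3 / 2) / 2 * real j"
      using mass[of j] by (simp add: k_def)
  qed (use fU U y in \<open>auto simp: k_def\<close>)
  have cA: "(\<Sum>B\<in>?A. (2 * k) ^ card B) \<le> (y powr (R + 2))\<^sup>2"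
  proof (rule sum_power_card_le[OF fU])
    show "real (\<Prod>B) \<le> y powr (R + 2)" if "B \<in> ?A" for B
      using brun_prod_le[OF fU y U(2), where B = B] that by blast
  qed (use U in \<open>auto simp: brun_accepted_def k_def\<close>)
  have cF: "(\<Sum>B\<in>?F. (2 * k) ^ card B) \<le> (y powr (R + 2))\<^sup>2"
  proof (rule sum_power_card_le[OF fU])
    show "real (\<Prod>B) \<le> y powr (R + 2)" if "B \<in> ?F" for B
      using brun_prod_le[OF fU y U(2), where B = B] that by blast
  qed (use U in \<open>auto simp: brun_rejected_def k_def\<close>)
  have sq: "(y powr (R + 2))\<^sup>2 = y powr (2 * (R + 2))"
    using y by (simp add: powr_add[symmetric] power2_eq_square algebra_simps)
  have "real N * ((\<Prod>p\<in>U. 1 - 2 * k / real p) + 2 * (\<Sum>C\<in>?F. \<Prod>p\<in>C. 2 * k / real p))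
     \<le> real N * (exp (- 2 * real (card I) * recip_mass P 0 y) + 6 * exp (2 * B) / 2 ^ R)"
    using V F by (intro mult_left_mono) (simp_all add: mU k_def)
  then show ?thesis using bound cA cF unfolding sq by linarith
qed

text \<open>Ignoring the primes beyond \<open>y\<close> can flip the sign only at those n where one
  of them divides a form, at a cost of 2 each.\<close>

lemma sum_sign_residue_class_le:
  assumes y: "y \<ge> 1" and A: "\<And>i. i \<in> I \<Longrightarrow> a i + h i \<le> A"
    and mass: "\<And>j. 2 * real (card I) * recip_mass P (y powr (1 / 2 ^ j)) y \<le> B + ln (3 / 2) / 2 * real j"
  shows "\<bar>\<Sum>n | n \<in> {1..N} \<and> [n = b] (mod W). (-1) ^ card (divisors_at n)\<bar>
    \<le> real N * (exp (- 2 * real (card I) * recip_mass P 0 y) + 6 * exp (2 * B) / 2 ^ R) + 2 * y powr (2 * (R + 2))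
      + 2 * (real (card I) * real A * real N * recip_mass P y (real (A * N)))"
proof -
  let ?S = "{n. n \<in> {1..N} \<and> [n = b] (mod W)}"
  define E where "E = {n \<in> {1..N}. \<exists>p\<in>P. y < real p \<and> (\<exists>i\<in>I. p dvd a i * n + h i)}"
  let ?f = "\<lambda>n. (-1::real) ^ card (divisors_at n)"
  let ?g = "\<lambda>n. (-1::real) ^ card {p. p \<in> divisors_at n \<and> real p \<le> y}"
  have "\<bar>(\<Sum>n\<in>?S. ?f n) - (\<Sum>n\<in>?S. ?g n)\<bar> \<le> (\<Sum>n\<in>?S. \<bar>?f n - ?g n\<bar>)"
    by (simp add: sum_subtractf[symmetric])
  also have "\<dots> \<le> (\<Sum>n\<in>{1..N}. \<bar>?f n - ?g n\<bar>)" by (rule sum_mono2) auto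
  also have "\<dots> \<le> (\<Sum>n\<in>{1..N}. 2 * of_bool (n \<in> E))"
  proof (rule sum_mono)
    fix n assume n: "n \<in> {1..N}"
    show "\<bar>?f n - ?g n\<bar> \<le> 2 * of_bool (n \<in> E)"
    proof (cases "n \<in> E")
      case True
      have "\<bar>?f n\<bar> = 1" "\<bar>?g n\<bar> = 1" by (simp_all add: power_abs)
      then have "\<bar>?f n - ?g n\<bar> \<le> 2" by linarith
      then show ?thesis using True by simp
    next
      case False
      then have "{p. p \<in> divisors_at n \<and> real p \<le> y} = divisors_at n"
        using n by (force simp: divisors_at_def E_def)
      then show ?thesis by simp
    qed
  qed
  also have "\<dots> = 2 * real (card E)"
  proof -
    have "{1..N} \<inter> E = E" by (auto simp: E_def)
    then show ?thesis by (simp add: sum_distrib_left[symmetric])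
  qed
  also have "2 * real (card E) \<le> 2 * (real (card I) * real A * real N * recip_mass P y (real (A * N)))"
    using card_large_prime_le[OF fI a1 _ A, where y = y and N = N and P = P] y by (simp add: E_def)
  finally show ?thesis using small_primes_bound[OF y mass, of N b R] by linarith
qed

end

lemma filterlim_powr_at_top:
  fixes c :: real
  assumes "c > 0"
  shows "filterlim (\<lambda>x. x powr c) at_top at_top"
proof -
  have "filterlim (\<lambda>x. exp (c * ln x)) at_top at_top"
    using assms
    by (intro filterlim_compose[OF exp_at_top] filterlim_tendsto_pos_mult_at_top[OF tendsto_const] ln_at_top)
  moreover have "eventually (\<lambda>x. exp (c * ln x) = x powr c) at_top"
    using eventually_gt_at_top[of 0] by eventually_elim (simp add: powr_def)
  ultimately show ?thesis by (simp add: filterlim_cong)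
qed

context linear_forms
begin

lemma sum_sign_residue_class_tendsto_0:
  "(\<lambda>N. (\<Sum>n | n \<in> {1..N} \<and> [n = b] (mod W). (-1) ^ card (divisors_at n)) / real N) \<longlonglongrightarrow> 0"
  (is "(\<lambda>N. ?s N / real N) \<longlonglongrightarrow> 0")
proof (rule tendstoI)
  fix \<epsilon> :: real assume \<epsilon>: "\<epsilon> > 0"
  define k where "k = real (card I)"
  have k: "k > 0" using fI ne by (simp add: k_def card_gt_0_iff)
  define A where "A = (\<Sum>i\<in>I. a i + h i)"
  have A: "a i + h i \<le> A" if "i \<in> I" for i
    unfolding A_def using fI that by (intro member_le_sum) auto
  \<comment> \<open>The growth rate that becomes ln (3/2) / 2 once the masses carry the sieve weight
    2 * k.\<close>
  have "ln (3 / 2 :: real) / (4 * k) > 0" using k by simp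
  from recip_mass_root_le[OF sparse this]
  obtain B0 where B0: "\<And>y j. y \<ge> 0 \<Longrightarrow> recip_mass P (y powr (1 / 2 ^ j)) y \<le> B0 + ln (3 / 2) / (4 * k) * real j" by blast
  define B where "B = 2 * k * B0"
  have mass: "2 * k * recip_mass P (y powr (1 / 2 ^ j)) y \<le> B + ln (3 / 2) / 2 * real j" if "y \<ge> 1" for y j
  proof -
    have "2 * k * recip_mass P (y powr (1 / 2 ^ j)) y \<le> 2 * k * (B0 + ln (3 / 2) / (4 * k) * real j)"
      using B0[of y j] k that by (intro mult_left_mono) auto
    also have "\<dots> = B + ln (3 / 2) / 2 * real j" using k by (simp add: B_def field_simps)
    finally show ?thesis .
  qed
  \<comment> \<open>\<open>B\<close> does not depend on \<open>R\<close> or \<open>N\<close>, so the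
    rejected mass can be pushed below any bound.\<close>
  obtain R :: nat where "12 * exp (2 * B) / \<epsilon> < 2 ^ R" using real_arch_pow[of 2] by auto
  then have R: "6 * exp (2 * B) / 2 ^ R < \<epsilon> / 2" using \<epsilon> by (simp add: field_simps)
  \<comment> \<open>Since J < 2 ^ J, the exponent 2 * (R + 2) / 2 ^ J is at most 1/2, and the sieve
    remainder is at most twice the square root of N.\<close>
  define J where "J = 4 * (R + 2)"
  define y where "y = (\<lambda>N. real N powr (1 / 2 ^ J))"
  \<comment> \<open>Forms may take values up to \<open>A * N\<close>; for N >= A this is at most N
    squared. So the last mass is taken up to N squared, and one more square root,
    \<open>Suc J\<close>, gives the same lower end \<open>y N\<close>.\<close>
  define t where "t = (\<lambda>N. exp (- 2 * k * recip_mass P 0 (y N)) + 2 * real N powr (-1 / 2)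
     + 2 * k * real A * recip_mass P ((real N)\<^sup>2 powr (1 / 2 ^ Suc J)) ((real N)\<^sup>2))"
  have real_at_top: "filterlim real at_top sequentially" by (rule filterlim_real_sequentially)
  have y_top: "filterlim y at_top sequentially"
    unfolding y_def by (rule filterlim_compose[OF filterlim_powr_at_top real_at_top]) simp
  have "t \<longlonglongrightarrow> 0 + 2 * 0 + 2 * k * real A * 0"
    unfolding t_def
  proof (intro tendsto_add tendsto_mult tendsto_const)
    have "filterlim (\<lambda>N. 2 * k * recip_mass P 0 (y N)) at_top sequentially"
      using k by (intro filterlim_tendsto_pos_mult_at_top[OF tendsto_const] filterlim_compose[OF divergent y_top]) auto
    then have "filterlim (\<lambda>N. - (2 * k * recip_mass P 0 (y N))) at_bot sequentially"
      by (simp add: filterlim_uminus_at_top)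
    then show "(\<lambda>N. exp (- 2 * k * recip_mass P 0 (y N))) \<longlonglongrightarrow> 0"
      using filterlim_compose[OF exp_at_bot] by simp
    show "(\<lambda>N. real N powr (-1 / 2)) \<longlonglongrightarrow> 0"
      by (rule tendsto_neg_powr[OF _ real_at_top]) simp
    have "filterlim (\<lambda>N. (real N)\<^sup>2) at_top sequentially"
      by (intro filterlim_pow_at_top real_at_top) simp
    then show "(\<lambda>N. recip_mass P ((real N)\<^sup>2 powr (1 / 2 ^ Suc J)) ((real N)\<^sup>2)) \<longlonglongrightarrow> 0"
      by (rule filterlim_compose[OF recip_mass_root_tendsto_0[OF sparse]])
  qed
  then have "eventually (\<lambda>N. dist (t N) 0 < \<epsilon> / 2) sequentially"
    using \<epsilon> by (intro tendstoD) simp_all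
  moreover have "eventually (\<lambda>N. N \<ge> max 1 A) sequentially" by (rule eventually_ge_at_top)
  ultimately show "eventually (\<lambda>N. dist (?s N / real N) 0 < \<epsilon>) sequentially"
  proof eventually_elim
    case (elim N)
    have N: "real N \<ge> 1" "A \<le> N" using elim by auto
    have y1: "y N \<ge> 1" unfolding y_def using N by (intro ge_one_powr_ge_zero) auto
    have "4 * (R + 2) < 2 ^ J" unfolding J_def by (rule less_exp)
    then have "real (4 * (R + 2)) < real (2 ^ J)" by (simp only: of_nat_less_iff)
    then have "1 / 2 ^ J * (2 * (real R + 2)) \<le> 1 / 2" by (simp add: field_simps)
    then have "y N powr (2 * (R + 2)) \<le> real N powr (1 / 2)"
      unfolding y_def powr_powr using N by (intro powr_mono) auto
    also have "\<dots> = real N * real N powr (-1 / 2)"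
      using N powr_add[of "real N" 1 "-1 / 2"] by simp
    finally have y2: "y N powr (2 * (R + 2)) \<le> real N * real N powr (-1 / 2)" .
    have "recip_mass P (y N) (real (A * N)) \<le> recip_mass P ((real N)\<^sup>2 powr (1 / 2 ^ Suc J)) ((real N)\<^sup>2)"
    proof (rule recip_mass_mono)
      have "(real N)\<^sup>2 = real N powr 2" using N by simp
      then show "(real N)\<^sup>2 powr (1 / 2 ^ Suc J) \<le> y N" by (simp only: powr_powr y_def) simp
      show "real (A * N) \<le> (real N)\<^sup>2" using N by (simp add: power2_eq_square)
    qed simp
    then have m: "2 * (k * real A * real N * recip_mass P (y N) (real (A * N)))
        \<le> 2 * (k * real A * real N * recip_mass P ((real N)\<^sup>2 powr (1 / 2 ^ Suc J)) ((real N)\<^sup>2))"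
      using k by (intro mult_left_mono) auto
    have "\<bar>?s N\<bar> \<le> real N * (exp (- 2 * k * recip_mass P 0 (y N)) + 6 * exp (2 * B) / 2 ^ R)
      + 2 * y N powr (2 * (R + 2)) + 2 * (k * real A * real N * recip_mass P (y N) (real (A * N)))"
      unfolding k_def by (rule sum_sign_residue_class_le[OF y1 A mass[OF y1, unfolded k_def]])
    also have "\<dots> \<le> real N * (exp (- 2 * k * recip_mass P 0 (y N)) + 6 * exp (2 * B) / 2 ^ R)
      + 2 * (real N * real N powr (-1 / 2))
      + 2 * (k * real A * real N * recip_mass P ((real N)\<^sup>2 powr (1 / 2 ^ Suc J)) ((real N)\<^sup>2))"
      using y2 m by linarith
    also have "\<dots> = real N * (t N + 6 * exp (2 * B) / 2 ^ R)"
      by (simp add: t_def algebra_simps)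
    also have "\<dots> < real N * \<epsilon>"
    proof (rule mult_strict_left_mono)
      have "t N < \<epsilon> / 2" using elim(1) by (simp add: dist_real_def)
      then show "t N + 6 * exp (2 * B) / 2 ^ R < \<epsilon>" using R by simp
    qed (use N in simp)
    finally show ?case using N by (simp add: dist_real_def field_simps)
  qed
qed

lemma sum_periodic_sign_tendsto_0:
  fixes S :: "nat \<Rightarrow> real"
  assumes S: "\<And>n. S n = S (n mod W)"
  shows "(\<lambda>N. (\<Sum>n\<in>{1..N}. S n * (-1) ^ card (divisors_at n)) / real N) \<longlonglongrightarrow> 0"
proof -
  have "(\<Sum>n\<in>{1..N}. S n * (-1) ^ card (divisors_at n))
     = (\<Sum>b<W. S b * (\<Sum>n | n \<in> {1..N} \<and> [n = b] (mod W). (-1) ^ card (divisors_at n)))" for N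
  proof -
    have "(\<Sum>n\<in>{1..N}. S n * (-1) ^ card (divisors_at n))
       = (\<Sum>b<W. \<Sum>n | n \<in> {1..N} \<and> n mod W = b. S n * (-1) ^ card (divisors_at n))"
      using W1 by (intro sum.group[symmetric]) auto
    also have "\<dots> = (\<Sum>b<W. \<Sum>n | n \<in> {1..N} \<and> [n = b] (mod W). S b * (-1) ^ card (divisors_at n))"
    proof (intro sum.cong)
      fix b assume "b \<in> {..<W}"
      then show "{n. n \<in> {1..N} \<and> n mod W = b} = {n. n \<in> {1..N} \<and> [n = b] (mod W)}"
        by (auto simp: cong_def)
      fix n assume "n \<in> {n. n \<in> {1..N} \<and> [n = b] (mod W)}"
      then have "n mod W = b" using \<open>b \<in> {..<W}\<close> by (auto simp: cong_def)
      then show "S n * (-1) ^ card (divisors_at n) = S b * (-1) ^ card (divisors_at n)"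
        using S[of n] by simp
    qed simp
    finally show ?thesis by (simp add: sum_distrib_left)
  qed
  then have "(\<lambda>N. (\<Sum>n\<in>{1..N}. S n * (-1) ^ card (divisors_at n)) / real N)
     = (\<lambda>N. \<Sum>b<W. S b * ((\<Sum>n | n \<in> {1..N} \<and> [n = b] (mod W). (-1) ^ card (divisors_at n)) / real N))"
    by (simp only: sum_divide_distrib[of _ "{..<W}"] times_divide_eq_right)
  moreover have "\<dots> \<longlonglongrightarrow> (\<Sum>b<W. S b * 0)"
    by (intro tendsto_sum tendsto_mult tendsto_const sum_sign_residue_class_tendsto_0)
  ultimately show ?thesis by simp
qed

end

subsection \<open>Small primes and repeated factors\<close>

text \<open>Telescoping with 1 / (M + 1)^2 <= 1 / M - 1 / (M + 1).\<close>

lemma sum_inverse_squares_le: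
  fixes w M :: nat
  assumes "w \<ge> 1"
  shows "(\<Sum>p\<in>{w<..M}. 1 / (real p)\<^sup>2) \<le> 1 / real w"
proof (cases "w \<le> M")
  case True
  then have "(\<Sum>p\<in>{w<..M}. 1 / (real p)\<^sup>2) \<le> 1 / real w - 1 / real M"
  proof (induction M rule: dec_induct)
    case (step M)
    have "{w<..Suc M} = insert (Suc M) {w<..M}" using step by auto
    moreover have "1 / (real (Suc M))\<^sup>2 \<le> 1 / real M - 1 / real (Suc M)"
    proof -
      have M: "M \<ge> 1" using step assms by simp
      then have "1 / real M - 1 / real (Suc M) = 1 / (real M * real (Suc M))" by (simp add: field_simps)
      moreover have "1 / (real (Suc M))\<^sup>2 \<le> 1 / (real M * real (Suc M))"
        using M by (intro divide_left_mono) (auto simp: power2_eq_square)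
      ultimately show ?thesis by simp
    qed
    ultimately show ?case using step by simp
  qed simp
  moreover have "1 / real M \<ge> 0" by simp
  ultimately show ?thesis by linarith
qed simp

text \<open>Bounds the n at which the multiplicities are out of control: a high power of a small
  prime, or the square of a large one. The density is small if \<open>w\<close> is chosen large
  first and \<open>K\<close> afterwards.\<close>

lemma card_square_or_high_power_le:
  fixes a h :: "'i \<Rightarrow> nat" and T P :: "nat set" and w K A N :: nat
  assumes I: "finite I" "\<And>i. i \<in> I \<Longrightarrow> a i \<ge> 1" and A: "\<And>i. i \<in> I \<Longrightarrow> a i + h i \<le> A"
    and T: "\<And>p. p \<in> T \<Longrightarrow> 2 \<le> p \<and> p \<le> w" and P: "\<And>p. p \<in> P \<Longrightarrow> w < p" and w: "w \<ge> 1"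
  shows "real (card {n \<in> {1..N}. \<exists>i\<in>I. (\<exists>p\<in>T. p ^ Suc K dvd a i * n + h i) \<or> (\<exists>p\<in>P. p\<^sup>2 dvd a i * n + h i)})
     \<le> real N * (real (card I) * real A * (real w / 2 ^ K + 1 / real w))"
proof -
  define B1 where "B1 = (\<lambda>i p. {n \<in> {1..N}. p ^ Suc K dvd a i * n + h i})"
  define B2 where "B2 = (\<lambda>i p. {n \<in> {1..N}. p\<^sup>2 dvd a i * n + h i})"
  define E where "E = (\<lambda>i. (\<Union>p\<in>T. B1 i p) \<union> (\<Union>p\<in>P \<inter> {w<..A * N}. B2 i p))"
  have fT: "finite T" using T by (intro finite_subset[of T "{..w}"]) auto
  have card1: "real (card {n \<in> {1..N}. q dvd a i * n + h i}) \<le> real A * real N / real q" if "i \<in> I" "q \<ge> 1" for i q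
  proof -
    have "real (a i + h i) * real N / real q \<le> real A * real N / real q"
      using A[OF that(1)] by (intro divide_right_mono mult_right_mono of_nat_mono) auto
    then show ?thesis using card_dvd_linear_form_le[OF I(2)[OF that(1)] that(2), of N "h i"] by linarith
  qed
  have cE: "real (card (E i)) \<le> real A * real N * (real w / 2 ^ K + 1 / real w)" if i: "i \<in> I" for i
  proof -
    have "card (E i) \<le> card (\<Union>p\<in>T. B1 i p) + card (\<Union>p\<in>P \<inter> {w<..A * N}. B2 i p)"
      unfolding E_def by (rule card_Un_le)
    also have "\<dots> \<le> (\<Sum>p\<in>T. card (B1 i p)) + (\<Sum>p\<in>P \<inter> {w<..A * N}. card (B2 i p))"
      using fT by (intro add_mono card_UN_le) auto
    finally have "real (card (E i)) \<le> real ((\<Sum>p\<in>T. card (B1 i p)) + (\<Sum>p\<in>P \<inter> {w<..A * N}. card (B2 i p)))"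
      by (rule of_nat_mono)
    also have "\<dots> = (\<Sum>p\<in>T. real (card (B1 i p))) + (\<Sum>p\<in>P \<inter> {w<..A * N}. real (card (B2 i p)))" by simp
    also have "(\<Sum>p\<in>T. real (card (B1 i p))) \<le> (\<Sum>p\<in>T. real A * real N / 2 ^ K)"
    proof (rule sum_mono)
      fix p assume p: "p \<in> T"
      then have p2: "2 \<le> p" using T by auto
      have "real (card (B1 i p)) \<le> real A * real N / real (p ^ Suc K)"
        unfolding B1_def using p2 by (intro card1 i) simp
      also have "\<dots> \<le> real A * real N / 2 ^ K"
      proof (rule divide_left_mono)
        have "(2::nat) ^ K \<le> 2 ^ Suc K" by (rule power_increasing) auto
        also have "\<dots> \<le> p ^ Suc K" using p2 by (rule power_mono) simp
        finally have "real (2 ^ K) \<le> real (p ^ Suc K)" by (rule of_nat_mono)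
        then show "2 ^ K \<le> real (p ^ Suc K)" by simp
      qed (use p2 in auto)
      finally show "real (card (B1 i p)) \<le> real A * real N / 2 ^ K" .
    qed
    also have "\<dots> = real (card T) * (real A * real N / 2 ^ K)" by simp
    also have "\<dots> \<le> real w * (real A * real N / 2 ^ K)"
    proof (rule mult_right_mono)
      have "card T \<le> card {1..w}" using T by (intro card_mono) force+
      then show "real (card T) \<le> real w" by simp
    qed simp
    also have "(\<Sum>p\<in>P \<inter> {w<..A * N}. real (card (B2 i p))) \<le> (\<Sum>p\<in>P \<inter> {w<..A * N}. real A * real N * (1 / (real p)\<^sup>2))"
    proof (rule sum_mono)
      fix p assume "p \<in> P \<inter> {w<..A * N}"
      then have "p\<^sup>2 \<ge> 1" by simp
      from card1[OF i this] show "real (card (B2 i p)) \<le> real A * real N * (1 / (real p)\<^sup>2)"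
        unfolding B2_def by simp
    qed
    also have "\<dots> \<le> (\<Sum>p\<in>{w<..A * N}. real A * real N * (1 / (real p)\<^sup>2))"
      by (rule sum_mono2) auto
    also have "\<dots> = real A * real N * (\<Sum>p\<in>{w<..A * N}. 1 / (real p)\<^sup>2)"
      by (simp add: sum_distrib_left)
    also have "\<dots> \<le> real A * real N * (1 / real w)"
      by (intro mult_left_mono sum_inverse_squares_le w) simp
    finally show ?thesis by (simp add: algebra_simps)
  qed
  have "{n \<in> {1..N}. \<exists>i\<in>I. (\<exists>p\<in>T. p ^ Suc K dvd a i * n + h i) \<or> (\<exists>p\<in>P. p\<^sup>2 dvd a i * n + h i)} \<subseteq> (\<Union>i\<in>I. E i)"
  proof
    fix n assume n: "n \<in> {n \<in> {1..N}. \<exists>i\<in>I. (\<exists>p\<in>T. p ^ Suc K dvd a i * n + h i) \<or> (\<exists>p\<in>P. p\<^sup>2 dvd a i * n + h i)}"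
    then obtain i where i: "i \<in> I" "(\<exists>p\<in>T. p ^ Suc K dvd a i * n + h i) \<or> (\<exists>p\<in>P. p\<^sup>2 dvd a i * n + h i)" by auto
    have n1: "1 \<le> n" "n \<le> N" using n by auto
    have "p \<in> {w<..A * N}" if p: "p \<in> P" "p\<^sup>2 dvd a i * n + h i" for p
    proof -
      have "p dvd a i * n + h i" using p(2) by (auto simp: power2_eq_square dest: dvd_mult_left)
      then have "p \<le> a i * n + h i" using I(2)[OF i(1)] n1 by (intro dvd_imp_le) (auto simp: Suc_le_eq)
      also have "\<dots> \<le> a i * N + h i * N" using n1 by (intro add_mono) auto
      also have "\<dots> \<le> A * N" using A[OF i(1)] by (metis add_mult_distrib mult_le_mono1)
      finally show ?thesis using P[OF p(1)] by simp
    qed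
    then have "n \<in> E i" using i(2) n unfolding E_def B1_def B2_def by blast
    then show "n \<in> (\<Union>i\<in>I. E i)" using i(1) by blast
  qed
  then have "card {n \<in> {1..N}. \<exists>i\<in>I. (\<exists>p\<in>T. p ^ Suc K dvd a i * n + h i) \<or> (\<exists>p\<in>P. p\<^sup>2 dvd a i * n + h i)} \<le> card (\<Union>i\<in>I. E i)"
    using I fT by (intro card_mono) (auto simp: E_def B1_def B2_def)
  also have "\<dots> \<le> (\<Sum>i\<in>I. card (E i))" using I by (intro card_UN_le)
  finally have "real (card {n \<in> {1..N}. \<exists>i\<in>I. (\<exists>p\<in>T. p ^ Suc K dvd a i * n + h i) \<or> (\<exists>p\<in>P. p\<^sup>2 dvd a i * n + h i)})
      \<le> (\<Sum>i\<in>I. real (card (E i)))" by (simp only: of_nat_le_iff flip: of_nat_sum)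
  also have "\<dots> \<le> (\<Sum>i\<in>I. real A * real N * (real w / 2 ^ K + 1 / real w))" by (intro sum_mono cE)
  finally show ?thesis by (simp add: algebra_simps)
qed

text \<open>For a prime and positive m this is the minimum of \<open>K\<close> and the multiplicity.
  As a count of divisibility conditions it visibly depends on m modulo p ^ K only, which makes the
  small primes periodic; \<open>K = 1\<close> gives the indicator needed for
  \<open>omega_in\<close>.\<close>

definition truncated_exponent :: "nat \<Rightarrow> nat \<Rightarrow> nat \<Rightarrow> nat" where
  "truncated_exponent K p m = card {j \<in> {1..K}. p ^ j dvd m}"

lemma prime_power_dvd_iff:
  assumes "prime p" "m \<ge> (1::nat)"
  shows "p ^ j dvd m \<longleftrightarrow> j \<le> multiplicity p m"
proof (rule power_dvd_iff_le_multiplicity)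
  show "m \<noteq> 0" using assms by simp
  show "\<not> is_unit p" using assms(1) not_prime_unit[of p] by blast
qed

lemma truncated_exponent_eq_min:
  assumes "prime p" "m \<ge> (1::nat)"
  shows "truncated_exponent K p m = min K (multiplicity p m)"
proof -
  have "{j \<in> {1..K}. p ^ j dvd m} = {1..min K (multiplicity p m)}"
    unfolding prime_power_dvd_iff[OF assms] by auto
  then show ?thesis by (simp add: truncated_exponent_def)
qed

lemma omega_in_split:
  assumes P: "\<And>p. p \<in> P \<Longrightarrow> prime p" and "m \<ge> 1"
  shows "omega_in P m = (\<Sum>p\<in>{p \<in> P. p \<le> w}. truncated_exponent 1 p m) + card {p \<in> P. w < p \<and> p dvd m}"
proof -
  have eq: "{p \<in> prime_factors m. p \<in> P} = {p \<in> P. p \<le> w \<and> p dvd m} \<union> {p \<in> P. w < p \<and> p dvd m}"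
    using assms by (auto simp: prime_factors_dvd)
  have fin: "finite {p. p dvd m}" using assms(2) by simp
  have "omega_in P m = card {p \<in> P. p \<le> w \<and> p dvd m} + card {p \<in> P. w < p \<and> p dvd m}"
    unfolding omega_in_def eq by (intro card_Un_disjoint) (auto intro: finite_subset[OF _ fin])
  moreover have "truncated_exponent 1 p m = of_bool (p dvd m)" for p
  proof -
    have "{j \<in> {1..1}. p ^ j dvd m} = (if p dvd m then {1} else {})" by auto
    then show ?thesis by (simp add: truncated_exponent_def)
  qed
  moreover have "{p \<in> P. p \<le> w} \<inter> {p. p dvd m} = {p \<in> P. p \<le> w \<and> p dvd m}" by auto
  ultimately show ?thesis by simp
qed

text \<open>Off the exceptional set the truncation at \<open>K\<close> loses nothing, and every
  large prime divisor has multiplicity exactly 1, so beyond \<open>w\<close> a plain count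
  suffices.\<close>

lemma bigomega_in_split:
  assumes P: "\<And>p. p \<in> P \<Longrightarrow> prime p" and m: "m \<ge> 1"
    and small: "\<And>p. p \<in> P \<Longrightarrow> p \<le> w \<Longrightarrow> \<not> p ^ Suc K dvd m"
    and big: "\<And>p. p \<in> P \<Longrightarrow> w < p \<Longrightarrow> \<not> p\<^sup>2 dvd m"
  shows "bigomega_in P m = (\<Sum>p\<in>{p \<in> P. p \<le> w}. truncated_exponent K p m) + card {p \<in> P. w < p \<and> p dvd m}"
proof -
  let ?Q = "prime_factors m \<inter> P"
  have small_mult: "truncated_exponent K p m = multiplicity p m" if "p \<in> P" "p \<le> w" for p
  proof -
    have "multiplicity p m < Suc K"
      using small[OF that] prime_power_dvd_iff[OF P[OF that(1)] m] by (metis not_le)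
    then show ?thesis using truncated_exponent_eq_min[OF P[OF that(1)] m] by simp
  qed
  have big_mult: "multiplicity p m = 1" if "p \<in> P" "w < p" "p dvd m" for p
  proof -
    have "multiplicity p m < 2"
      using big[OF that(1,2)] prime_power_dvd_iff[OF P[OF that(1)] m] by (metis not_le)
    moreover have "multiplicity p m \<ge> 1"
      using that(3) prime_power_dvd_iff[OF P[OF that(1)] m, of 1] by (metis power_one_right)
    ultimately show ?thesis by simp
  qed
  have "bigomega_in P m = (\<Sum>p\<in>?Q. multiplicity p m)"
  proof -
    have "bigomega_in P m = (\<Sum>p\<in>set_mset (filter_mset (\<lambda>p. p \<in> P) (prime_factorization m)).
        count (filter_mset (\<lambda>p. p \<in> P) (prime_factorization m)) p)"
      unfolding bigomega_in_def by (rule size_multiset_overloaded_eq)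
    also have "\<dots> = (\<Sum>p\<in>?Q. multiplicity p m)"
      by (intro sum.cong) (auto simp: count_prime_factorization_prime in_prime_factors_imp_prime)
    finally show ?thesis .
  qed
  also have "?Q = {p \<in> P. p \<le> w \<and> p dvd m} \<union> {p \<in> P. w < p \<and> p dvd m}"
    using m P by (auto simp: prime_factors_dvd)
  also have "(\<Sum>p\<in>{p \<in> P. p \<le> w \<and> p dvd m} \<union> {p \<in> P. w < p \<and> p dvd m}. multiplicity p m)
    = (\<Sum>p\<in>{p \<in> P. p \<le> w \<and> p dvd m}. multiplicity p m) + (\<Sum>p\<in>{p \<in> P. w < p \<and> p dvd m}. multiplicity p m)"
  proof -
    have fin: "finite {p. p dvd m}" using m by simp
    show ?thesis by (intro sum.union_disjoint) (auto intro: finite_subset[OF _ fin])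
  qed
  also have "(\<Sum>p\<in>{p \<in> P. w < p \<and> p dvd m}. multiplicity p m) = card {p \<in> P. w < p \<and> p dvd m}"
    using big_mult by simp
  also have "(\<Sum>p\<in>{p \<in> P. p \<le> w \<and> p dvd m}. multiplicity p m) = (\<Sum>p\<in>{p \<in> P. p \<le> w}. multiplicity p m)"
    by (intro sum.mono_neutral_left) (auto intro: finite_subset[of _ "{..w}"] intro!: ccontr[of "_ dvd _"] simp: not_dvd_imp_multiplicity_0)
  also have "\<dots> = (\<Sum>p\<in>{p \<in> P. p \<le> w}. truncated_exponent K p m)"
    using small_mult by simp
  finally show ?thesis .
qed

lemma truncated_exponent_mod:
  assumes "p ^ K dvd W"
  shows "truncated_exponent K p (a * (n mod W) + h) = truncated_exponent K p (a * n + h)"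
proof -
  have "p ^ j dvd a * (n mod W) + h \<longleftrightarrow> p ^ j dvd a * n + h" if "j \<le> K" for j
  proof -
    have "p ^ j dvd W" using assms that le_imp_power_dvd dvd_trans by blast
    then have "[n mod W = n] (mod p ^ j)" by (metis cong_def mod_mod_cancel)
    then have "[a * (n mod W) + h = a * n + h] (mod p ^ j)" by (intro cong_add cong_mult cong_refl)
    then show ?thesis by (rule cong_dvd_iff)
  qed
  then show ?thesis unfolding truncated_exponent_def
    by (intro arg_cong[of _ _ card]) auto
qed

text \<open>The cut \<open>w\<close>, and with it the approximating function, has to depend on the
  accuracy; this lemma lets it.\<close>

lemma mean_tendsto_0_if_approximable:
  fixes F :: "nat \<Rightarrow> real"
  assumes "\<And>\<epsilon>. \<epsilon> > 0 \<Longrightarrow> \<exists>g :: nat \<Rightarrow> real. (\<lambda>N. (\<Sum>n\<in>{1..N}. g n) / real N) \<longlonglongrightarrow> 0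
     \<and> (\<forall>N. (\<Sum>n\<in>{1..N}. \<bar>F n - g n\<bar>) \<le> \<epsilon> * real N)"
  shows "(\<lambda>N. (\<Sum>n\<in>{1..N}. F n) / real N) \<longlonglongrightarrow> 0"
proof (rule tendstoI)
  fix \<epsilon> :: real assume \<epsilon>: "\<epsilon> > 0"
  from assms[of "\<epsilon> / 2"] \<epsilon> obtain g :: "nat \<Rightarrow> real"
    where g: "(\<lambda>N. (\<Sum>n\<in>{1..N}. g n) / real N) \<longlonglongrightarrow> 0"
    and Fg: "\<And>N. (\<Sum>n\<in>{1..N}. \<bar>F n - g n\<bar>) \<le> \<epsilon> / 2 * real N" by auto
  have "eventually (\<lambda>N. dist ((\<Sum>n\<in>{1..N}. g n) / real N) 0 < \<epsilon> / 2) sequentially"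
    using g \<epsilon> by (intro tendstoD) simp_all
  moreover have "eventually (\<lambda>N. N \<ge> 1) sequentially" by (rule eventually_ge_at_top)
  ultimately show "eventually (\<lambda>N. dist ((\<Sum>n\<in>{1..N}. F n) / real N) 0 < \<epsilon>) sequentially"
  proof eventually_elim
    case (elim N)
    have "\<bar>(\<Sum>n\<in>{1..N}. F n) - (\<Sum>n\<in>{1..N}. g n)\<bar> \<le> (\<Sum>n\<in>{1..N}. \<bar>F n - g n\<bar>)"
      by (simp add: sum_subtractf[symmetric])
    also have "\<dots> \<le> \<epsilon> / 2 * real N" by (rule Fg)
    finally have 1: "\<bar>(\<Sum>n\<in>{1..N}. F n) - (\<Sum>n\<in>{1..N}. g n)\<bar> \<le> \<epsilon> / 2 * real N" .
    have 2: "\<bar>\<Sum>n\<in>{1..N}. g n\<bar> < \<epsilon> / 2 * real N"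
      using elim by (simp add: dist_real_def field_simps)
    have "\<bar>\<Sum>n\<in>{1..N}. F n\<bar> < \<epsilon> * real N" using 1 2 by linarith
    then show ?case using elim by (simp add: dist_real_def field_simps)
  qed
qed

text \<open>The combination a * (a' * n + h') - a' * (a * n + h) eliminates n and leaves the nonzero
  determinant a * h' - a' * h.\<close>

lemma prime_dvd_two_forms_le:
  fixes a h a' h' p n A :: nat
  assumes "p dvd a * n + h" "p dvd a' * n + h'" "a * h' \<noteq> a' * h"
    and "a \<le> A" "h \<le> A" "a' \<le> A" "h' \<le> A"
  shows "p \<le> A\<^sup>2"
proof -
  have "int p dvd int a * (int a' * int n + int h') - int a' * (int a * int n + int h)"
    using assms(1,2) by (intro dvd_diff dvd_mult) (simp_all flip: of_nat_mult of_nat_add)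
  also have "\<dots> = int (a * h') - int (a' * h)" by (simp add: algebra_simps)
  finally have dvd: "int p dvd int (a * h') - int (a' * h)" .
  have "int (a * h') - int (a' * h) \<noteq> 0" using assms(3) by (simp only: right_minus_eq of_nat_eq_iff not_False_eq_True)
  from dvd_imp_le_int[OF this dvd] have "int p \<le> \<bar>int (a * h') - int (a' * h)\<bar>" by simp
  also have "\<dots> \<le> int (A\<^sup>2)"
  proof -
    have "a * h' \<le> A * A" "a' * h \<le> A * A" using assms by (intro mult_le_mono; simp)+
    then have "int (a * h') \<le> int (A\<^sup>2)" "int (a' * h) \<le> int (A\<^sup>2)"
      by (simp_all only: power2_eq_square of_nat_le_iff)
    then show ?thesis by linarith
  qed
  finally show ?thesis by simp
qed

theorem theorem2p1:
  fixes P :: "nat set" and f :: "nat \<Rightarrow> real" and k :: nat and a h :: "nat \<Rightarrow> nat"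
  assumes "\<And>p. p \<in> P \<Longrightarrow> prime p"
    and "has_relative_prime_density P 0"
    and "(\<Sum>\<^sub>\<infinity>p\<in>P. ennreal (1 / real p)) = \<infinity>"
    and "f = (\<lambda>n. (-1) ^ omega_in P n) \<or> f = (\<lambda>n. (-1) ^ bigomega_in P n)"
    and "k \<ge> 1"
    and "\<And>i. i \<in> {1..k} \<Longrightarrow> a i \<ge> 1 \<and> h i \<ge> 1"
    and "\<And>i j. i \<in> {1..k} \<Longrightarrow> j \<in> {1..k} \<Longrightarrow> i \<noteq> j \<Longrightarrow> a i * h j \<noteq> a j * h i"
  shows "((\<lambda>x::real. 1 / x * (\<Sum>n | 1 \<le> n \<and> real n \<le> x. \<Prod>i=1..k. f (a i * n + h i)))
           \<longlongrightarrow> 0) at_top"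
proof -
  define I where "I = {1..k}"
  define F where "F = (\<lambda>n. \<Prod>i\<in>I. f (a i * n + h i))"
  define A where "A = (\<Sum>i\<in>I. a i + h i)"
  have I: "finite I" "I \<noteq> {}" "card I = k" using assms(5) by (auto simp: I_def)
  have a1: "a i \<ge> 1" if "i \<in> I" for i using assms(6) that by (simp add: I_def)
  have A: "a i + h i \<le> A" if "i \<in> I" for i
    unfolding A_def using I that by (intro member_le_sum) auto
  have m1: "a i * n + h i \<ge> 1" if "i \<in> I" for i n using assms(6)[of i] that by (simp add: I_def)
  have f1: "\<bar>f m\<bar> = 1" for m using assms(4) by (auto simp: power_abs)
  have F1: "\<bar>F n\<bar> = 1" for n by (simp add: F_def abs_prod f1)

  have "(\<lambda>N. (\<Sum>n\<in>{1..N}. F n) / real N) \<longlonglongrightarrow> 0"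
  proof (rule mean_tendsto_0_if_approximable)
    fix \<epsilon> :: real assume \<epsilon>: "\<epsilon> > 0"
    \<comment> \<open>The exceptional density carries the factor k * A, and each exceptional n costs
      2.\<close>
    define c where "c = 2 * real k * real A"
    have c0: "c \<ge> 0" by (simp add: c_def)
    obtain w0 :: nat where w0: "2 * c / \<epsilon> < real w0" using reals_Archimedean2 by blast
    \<comment> \<open>\<open>w0\<close> makes the tail over squares small, \<open>A\<^sup>2\<close>
      lets a prime above \<open>w\<close> divide at most one form, \<open>A\<close> makes it coprime
      to the coefficients, and \<open>2 * k\<close> serves the sieve.\<close>
    define w where "w = Max {1, w0, A\<^sup>2, A, 2 * k}"
    have w: "1 \<le> w" "w0 \<le> w" "A\<^sup>2 \<le> w" "A \<le> w" "2 * k \<le> w" unfolding w_def by simp_all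
    have "2 * c / \<epsilon> < real w" using w0 w(2) by simp
    then have cw: "c * (1 / real w) \<le> \<epsilon> / 2" using \<epsilon> w(1) by (simp add: field_simps)
    \<comment> \<open>Chosen after \<open>w\<close>, since the bound for the high powers is
      proportional to w / 2 ^ K0.\<close>
    obtain K0 :: nat where K0: "2 * c * real w / \<epsilon> < 2 ^ K0" using real_arch_pow[of 2] by auto
    define Q where "Q = {p \<in> P. w < p}"
    define T where "T = {p \<in> P. p \<le> w}"
    have fT: "finite T" by (rule finite_subset[of _ "{..w}"]) (auto simp: T_def)
    have TP: "prime p" "2 \<le> p" "p \<le> w" if "p \<in> T" for p
      using that assms(1) prime_ge_2_nat by (auto simp: T_def)
    have QP: "prime p" "w < p" "p \<in> P" if "p \<in> Q" for p
      using that assms(1) by (auto simp: Q_def)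

    define \<omega> where "\<omega> = (\<lambda>m. card {p \<in> P. w < p \<and> p dvd m})"
    define Bad where "Bad = (\<lambda>n. \<exists>i\<in>I. (\<exists>p\<in>T. p ^ Suc K0 dvd a i * n + h i) \<or> (\<exists>p\<in>Q. p\<^sup>2 dvd a i * n + h i))"
    \<comment> \<open>The two choices of \<open>f\<close> differ from here on only in
      \<open>K\<close>: 1 for distinct primes, valid for every n, and \<open>K0\<close> with
      multiplicity, valid off the exceptional set.\<close>
    have "\<exists>K. \<forall>n. \<not> Bad n \<longrightarrow> (\<forall>i\<in>I. f (a i * n + h i) =
        (-1) ^ (\<Sum>p\<in>T. truncated_exponent K p (a i * n + h i)) * (-1) ^ \<omega> (a i * n + h i))"
      using assms(4)
    proof
      assume f: "f = (\<lambda>n. (-1) ^ omega_in P n)"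
      show ?thesis
      proof (intro exI[of _ 1] allI impI ballI)
        fix n i assume "i \<in> I"
        show "f (a i * n + h i) = (-1) ^ (\<Sum>p\<in>T. truncated_exponent 1 p (a i * n + h i)) * (-1) ^ \<omega> (a i * n + h i)"
          using omega_in_split[OF assms(1) m1[OF \<open>i \<in> I\<close>], where w = w] by (simp add: f T_def \<omega>_def power_add)
      qed
    next
      assume f: "f = (\<lambda>n. (-1) ^ bigomega_in P n)"
      show ?thesis
      proof (intro exI[of _ K0] allI impI ballI)
        fix n i assume "\<not> Bad n" "i \<in> I"
        then have "bigomega_in P (a i * n + h i) = (\<Sum>p\<in>{p \<in> P. p \<le> w}. truncated_exponent K0 p (a i * n + h i))
            + card {p \<in> P. w < p \<and> p dvd a i * n + h i}"
          by (intro bigomega_in_split assms(1) m1) (auto simp: Bad_def T_def Q_def)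
        then show "f (a i * n + h i) = (-1) ^ (\<Sum>p\<in>T. truncated_exponent K0 p (a i * n + h i)) * (-1) ^ \<omega> (a i * n + h i)"
          by (simp add: f T_def \<omega>_def power_add)
      qed
    qed
    then obtain K where K: "\<And>n i. \<not> Bad n \<Longrightarrow> i \<in> I \<Longrightarrow> f (a i * n + h i) =
        (-1) ^ (\<Sum>p\<in>T. truncated_exponent K p (a i * n + h i)) * (-1) ^ \<omega> (a i * n + h i)" by blast
    \<comment> \<open>A period of the sign \<open>S\<close> contributed by the small primes, and
      coprime to all primes of \<open>Q\<close>.\<close>
    define W where "W = (\<Prod>T) ^ K"
    define S where "S = (\<lambda>n. \<Prod>i\<in>I. (-1 :: real) ^ (\<Sum>p\<in>T. truncated_exponent K p (a i * n + h i)))"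

    interpret L: linear_forms a h I Q W
    proof
      show "finite I" "I \<noteq> {}" by (fact I)+
      show "a i \<ge> 1" if "i \<in> I" for i using a1 that .
      have "\<Prod>T > 0" using TP by (intro prod_pos) force
      then show "W \<ge> 1" by (simp add: W_def Suc_le_eq)
      show "prime p" if "p \<in> Q" for p using QP that by blast
      show "coprime W p" if "p \<in> Q" for p
      proof -
        have "coprime q p" if "q \<in> T" for q
          using QP[OF \<open>p \<in> Q\<close>] TP[OF that] by (intro primes_coprime) auto
        then have "coprime (\<Prod>T) p" by (intro prod_coprime_left)
        then show ?thesis by (simp add: W_def)
      qed
      show "coprime (a i) p" if "p \<in> Q" "i \<in> I" for p i
      proof -
        have "a i < p" using A[OF that(2)] w(4) QP(2)[OF that(1)] by linarith
        then have "\<not> p dvd a i" using a1[OF that(2)] by (auto dest: dvd_imp_le)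
        then show ?thesis using QP(1)[OF that(1)] by (metis coprime_commute prime_imp_coprime_nat)
      qed
      show "i = j" if p: "p \<in> Q" and i: "i \<in> I" and j: "j \<in> I"
        and d: "p dvd a i * n + h i" "p dvd a j * n + h j" for p i j n
      proof (rule ccontr)
        assume "i \<noteq> j"
        then have "a i * h j \<noteq> a j * h i" using assms(7) i j by (simp add: I_def)
        then have "p \<le> A\<^sup>2" using d A[OF i] A[OF j] by (intro prime_dvd_two_forms_le[of p "a i" n "h i" "a j" "h j"]) auto
        then show False using w(3) QP(2)[OF p] by simp
      qed
      show "2 * card I \<le> p" if "p \<in> Q" for p using w(5) QP(2)[OF that] by (simp add: I)
      show "((\<lambda>t. recip_mass Q (sqrt t) t) \<longlongrightarrow> 0) at_top"
      proof (rule tendsto_sandwich[OF _ _ tendsto_const recip_mass_sqrt_tendsto_0[OF assms(2)]])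
        show "eventually (\<lambda>t. 0 \<le> recip_mass Q (sqrt t) t) at_top" by (simp add: recip_mass_nonneg)
        show "eventually (\<lambda>t. recip_mass Q (sqrt t) t \<le> recip_mass P (sqrt t) t) at_top"
          by (intro always_eventually allI recip_mass_mono) (auto simp: Q_def)
      qed
      \<comment> \<open>The divergence of the mass of \<open>P\<close> was proved from any starting
        point, so it may start at \<open>w\<close>.\<close>
      show "filterlim (recip_mass Q 0) at_top at_top"
      proof (rule filterlim_at_top_mono[OF filterlim_recip_mass_at_top[OF assms(3), of "real w"]])
        have "recip_mass P (real w) t \<le> recip_mass Q 0 t" for t
          unfolding recip_mass_def using w(1)
          by (intro sum_mono2 finite_nat_real_le) (auto simp: Q_def)
        then show "eventually (\<lambda>t. recip_mass P (real w) t \<le> recip_mass Q 0 t) at_top" by simp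
      qed
    qed

    have S_mod: "S n = S (n mod W)" for n
    proof -
      have "p ^ K dvd W" if "p \<in> T" for p
        unfolding W_def using fT that by (intro dvd_power_same dvd_prodI)
      then show ?thesis by (simp add: S_def truncated_exponent_mod)
    qed
    have \<omega>: "(\<Sum>i\<in>I. \<omega> (a i * n + h i)) = card (L.divisors_at n)" for n
    proof -
      have "L.divisors_at n = (\<Union>i\<in>I. {p \<in> P. w < p \<and> p dvd a i * n + h i})"
        unfolding L.divisors_at_def by (auto simp: Q_def)
      also have "card \<dots> = (\<Sum>i\<in>I. card {p \<in> P. w < p \<and> p dvd a i * n + h i})"
      proof (rule card_UN_disjoint[OF I(1)])
        show "\<forall>i\<in>I. finite {p \<in> P. w < p \<and> p dvd a i * n + h i}"
        proof
          fix i assume "i \<in> I"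
          then have "finite {p. p dvd a i * n + h i}" using m1[of i n] by (intro finite_divisors_nat) auto
          then show "finite {p \<in> P. w < p \<and> p dvd a i * n + h i}" by (rule rev_finite_subset) auto
        qed
        show "\<forall>i\<in>I. \<forall>j\<in>I. i \<noteq> j \<longrightarrow> {p \<in> P. w < p \<and> p dvd a i * n + h i} \<inter> {p \<in> P. w < p \<and> p dvd a j * n + h j} = {}"
          using L.dis by (auto simp: Q_def)
      qed
      finally show ?thesis by (simp add: \<omega>_def)
    qed
    define g where "g = (\<lambda>n. S n * (-1) ^ card (L.divisors_at n))"
    have S1: "\<bar>S n\<bar> = 1" for n by (simp add: S_def abs_prod power_abs)
    have g1: "\<bar>g n\<bar> = 1" for n by (simp add: g_def abs_mult S1 power_abs)
    have Fg: "\<bar>F n - g n\<bar> \<le> 2 * of_bool (Bad n)" for n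
    proof (cases "Bad n")
      case True
      then show ?thesis using F1[of n] g1[of n] by simp
    next
      case False
      then have "F n = (\<Prod>i\<in>I. (-1) ^ (\<Sum>p\<in>T. truncated_exponent K p (a i * n + h i)) * (-1) ^ \<omega> (a i * n + h i))"
        unfolding F_def by (intro prod.cong refl K)
      also have "\<dots> = S n * (\<Prod>i\<in>I. (-1) ^ \<omega> (a i * n + h i))" by (simp add: S_def prod.distrib)
      also have "(\<Prod>i\<in>I. (-1 :: real) ^ \<omega> (a i * n + h i)) = (-1) ^ (\<Sum>i\<in>I. \<omega> (a i * n + h i))"
        by (simp add: power_sum)
      finally show ?thesis by (simp add: g_def \<omega>)
    qed
    have "(\<Sum>n\<in>{1..N}. \<bar>F n - g n\<bar>) \<le> \<epsilon> * real N" for N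
    proof -
      have "(\<Sum>n\<in>{1..N}. \<bar>F n - g n\<bar>) \<le> (\<Sum>n\<in>{1..N}. 2 * of_bool (Bad n))" by (intro sum_mono Fg)
      also have "\<dots> = 2 * real (card {n \<in> {1..N}. Bad n})"
        by (simp add: sum_distrib_left[symmetric] Int_def)
      also have "\<dots> \<le> 2 * (real N * (real (card I) * real A * (real w / 2 ^ K0 + 1 / real w)))"
        unfolding Bad_def using TP QP w(1)
        by (intro mult_left_mono card_square_or_high_power_le I a1 A) auto
      also have "\<dots> = real N * (c * (real w / 2 ^ K0) + c * (1 / real w))"
        by (simp add: c_def I algebra_simps)
      also have "\<dots> \<le> real N * (\<epsilon> / 2 + \<epsilon> / 2)"
      proof (intro mult_left_mono add_mono cw)
        show "c * (real w / 2 ^ K0) \<le> \<epsilon> / 2" using K0 \<epsilon> by (simp add: field_simps)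
      qed simp
      finally show ?thesis by (simp add: mult.commute)
    qed
    moreover have "(\<lambda>N. (\<Sum>n\<in>{1..N}. g n) / real N) \<longlonglongrightarrow> 0"
      unfolding g_def by (rule L.sum_periodic_sign_tendsto_0[where S = S]) (rule S_mod)
    ultimately show "\<exists>g. (\<lambda>N. (\<Sum>n\<in>{1..N}. g n) / real N) \<longlonglongrightarrow> 0 \<and> (\<forall>N. (\<Sum>n\<in>{1..N}. \<bar>F n - g n\<bar>) \<le> \<epsilon> * real N)"
      by blast
  qed
  then have lim: "((\<lambda>x::real. \<bar>(\<Sum>n\<in>{1..nat \<lfloor>x\<rfloor>}. F n) / real (nat \<lfloor>x\<rfloor>)\<bar>) \<longlongrightarrow> 0) at_top"
    by (intro tendsto_rabs_zero filterlim_compose[OF _ filterlim_compose[OF filterlim_nat_sequentially filterlim_floor_sequentially]])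
  show ?thesis
  \<comment> \<open>For real x the sum is the one up to the floor of x, and dividing by x instead of
    its floor only decreases the absolute value.\<close>
  proof (rule Lim_null_comparison[OF _ lim])
    show "eventually (\<lambda>x::real. norm (1 / x * (\<Sum>n | 1 \<le> n \<and> real n \<le> x. \<Prod>i=1..k. f (a i * n + h i)))
        \<le> \<bar>(\<Sum>n\<in>{1..nat \<lfloor>x\<rfloor>}. F n) / real (nat \<lfloor>x\<rfloor>)\<bar>) at_top"
      using eventually_ge_at_top[of 1]
    proof eventually_elim
      case (elim x)
      have "{n. 1 \<le> n \<and> real n \<le> x} = {1..nat \<lfloor>x\<rfloor>}" using elim by (auto simp: le_nat_floor le_nat_iff le_floor_iff)
      moreover have "0 < real (nat \<lfloor>x\<rfloor>)" "real (nat \<lfloor>x\<rfloor>) \<le> x" using elim by (simp, linarith)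
      ultimately have "1 / x \<le> 1 / real (nat \<lfloor>x\<rfloor>)"
        and eq: "(\<Sum>n | 1 \<le> n \<and> real n \<le> x. \<Prod>i=1..k. f (a i * n + h i)) = (\<Sum>n\<in>{1..nat \<lfloor>x\<rfloor>}. F n)"
        by (auto simp: F_def I_def intro: divide_left_mono)
      from mult_right_mono[OF this(1) abs_ge_zero, of "\<Sum>n\<in>{1..nat \<lfloor>x\<rfloor>}. F n"]
      show ?case using elim unfolding eq by (simp add: abs_mult)
    qed
  qed
qed

end
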